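(* Let $r\ge0$ be an integer, let $X_1,\dots,X_n$ be i.i.d. real random variables with an $r$ times differentiable probability density $f$ and characteristic function $\varphi$, and let $f_n^{(r)}(x;h)$ be the sinc estimator of $f^{(r)}$. Let $\rho>0$ and $0<\alpha\le2$, and suppose that $$\frac{1}{2\pi}\int_{-\infty}^{\infty} t^{2r}e^{\rho|t|^\alpha}|\varphi(t)|^2\,dt=C<\infty .$$ Then there is a function $\varepsilon(h)$ of $h>0$ (not depending on $n$) with $0<\varepsilon(h)<1$ and $\varepsilon(h)\to0$ as $h\to0$ such that, for all $n\ge1$ and $h>0$, $$\mathrm{MISE}(f_n^{(r)}(x;h))\le\varepsilon(h)\,Ce^{-\rho/h^\alpha}+\frac{1}{\pi nh^{2r+1}}.$$
   Context: The characteristic function is $\varphi(t)=\mathrm{E}\,e^{itX_j}$. The sinc estimator of $f$ with bandwidth $h>0$ is $f_n(x;h)=\frac{1}{nh}\sum_{j=1}^nK_s\left(\frac{x-X_j}{h}\right)$ with $K_s(x)=\frac{\sin x}{\pi x}$ ($K_s(0)=1/\pi$). The sinc estimator of the derivative $f^{(r)}$ is the $r$-th derivative in $x$: $f_n^{(r)}(x;h)=\frac{1}{nh^{r+1}}\sum_{j=1}^nK_s^{(r)}\left(\frac{x-X_j}{h}\right)$. $\mathrm{MISE}(f_n^{(r)}(x;h))=\mathrm{E}\int_{-\infty}^{\infty}[f_n^{(r)}(x;h)-f^{(r)}(x)]^2\,dx$. The $0$-th derivative of a function is the function itself. *)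

theory Defs
  imports "HOL-Probability.Probability"
begin

definition times_differentiable :: "nat \<Rightarrow> (real \<Rightarrow> real) \<Rightarrow> bool" where
  "times_differentiable r f \<longleftrightarrow> (\<forall>k<r. \<forall>x. (deriv ^^ k) f differentiable (at x))"

definition prob_density :: "(real \<Rightarrow> real) \<Rightarrow> bool" where
  "prob_density f \<longleftrightarrow>
     f \<in> borel_measurable borel \<and> (\<forall>x. 0 \<le> f x) \<and> (\<integral>\<^sup>+ x. ennreal (f x) \<partial>lborel) = 1"

text \<open>For a probability density \<open>f\<close> this is \<open>E (iexp (t * X))\<close> for every random variable
  \<open>X\<close> with density \<open>f\<close>: the law \<open>distr M lborel X\<close> is \<open>density lborel f\<close>.\<close>

definition char_fun :: "(real \<Rightarrow> real) \<Rightarrow> real \<Rightarrow> complex" where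
  "char_fun f = char (density lborel (\<lambda>x. ennreal (f x)))"

definition iid_sample :: "'a measure \<Rightarrow> nat \<Rightarrow> (nat \<Rightarrow> 'a \<Rightarrow> real) \<Rightarrow> (real \<Rightarrow> real) \<Rightarrow> bool" where
  "iid_sample M n X f \<longleftrightarrow>
     prob_space M \<and>
     prob_space.indep_vars M (\<lambda>_. borel) X {1..n} \<and>
     (\<forall>j\<in>{1..n}. distributed M lborel (X j) (\<lambda>x. ennreal (f x)))"

definition sinc_kernel :: "real \<Rightarrow> real" where
  "sinc_kernel x = (if x = 0 then 1 / pi else sin x / (pi * x))"

definition sinc_estimator :: "nat \<Rightarrow> real \<Rightarrow> (nat \<Rightarrow> real) \<Rightarrow> real \<Rightarrow> real" where
  "sinc_estimator n h xs x = 1 / (real n * h) * (\<Sum>j=1..n. sinc_kernel ((x - xs j) / h))"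

definition sinc_deriv_estimator :: "nat \<Rightarrow> nat \<Rightarrow> real \<Rightarrow> (nat \<Rightarrow> real) \<Rightarrow> real \<Rightarrow> real" where
  "sinc_deriv_estimator r n h xs = (deriv ^^ r) (sinc_estimator n h xs)"

text \<open>The integrals are taken in the extended nonnegative reals, so that an infinite
  error is not silently replaced by \<open>0\<close>.\<close>

definition MISE ::
  "'a measure \<Rightarrow> (nat \<Rightarrow> 'a \<Rightarrow> real) \<Rightarrow> (real \<Rightarrow> real) \<Rightarrow> nat \<Rightarrow> nat \<Rightarrow> real \<Rightarrow> ennreal" where
  "MISE M X f r n h =
     (\<integral>\<^sup>+ \<omega>. (\<integral>\<^sup>+ x. ennreal ((sinc_deriv_estimator r n h (\<lambda>j. X j \<omega>) x - (deriv ^^ r) f x)\<^sup>2)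
        \<partial>lborel) \<partial>M)"

end

theory Submission
  imports Defs
begin

text \<open>
Everything happens on the frequency side. The sinc kernel is the inverse Fourier transform of an
indicator, so the derivative of the sinc estimator has the Fourier transform
\<open>(- (\<i> * t)) ^ r * empirical_char n xs t\<close>, cut off to \<open>\<bar>t\<bar> \<le> 1 / h\<close>
(\<open>funpow_deriv_sinc_estimator\<close>). The moment condition makes \<open>t ^ j * char_fun f t\<close> integrable for
all \<open>j \<le> r\<close> (\<open>integrable_power_char_fun\<close>). Hence Fourier inversion and differentiation under the
integral represent the derivative of the density in the same way (\<open>funpow_deriv_density\<close>), and the
error is a single Fourier integral.

Since an upper bound is wanted, only one half of Plancherel's identity is required:
\<open>\<integral> cmod (fourier_integral G x)\<^sup>2 \<le> 2 * pi * \<integral> cmod (G t)\<^sup>2\<close> for integrable \<open>G\<close> (\<open>plancherel_le\<close>). A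
normal weight in \<open>x\<close> turns the left side into a double integral against a nonnegative convolution
kernel of total mass \<open>2 * pi\<close>, so Schur's test gives the bound uniformly in the weight.

It remains to take expectations frequency by frequency (\<open>MISE_sinc_deriv_estimator_le\<close>). For
\<open>\<bar>t\<bar> \<le> 1 / h\<close> the expected squared distance between the empirical and the true characteristic function
is at most \<open>1 / n\<close>, and integrating \<open>t ^ (2 * r) / (2 * pi * n)\<close> over the window costs at most
\<open>1 / (pi * n * h ^ (2 * r + 1))\<close>. For \<open>\<bar>t\<bar> > 1 / h\<close> the error is the missing part of the
characteristic function, and there the weight \<open>exp (\<rho> * \<bar>t\<bar> powr \<alpha>)\<close> is at least
\<open>exp (\<rho> / h powr \<alpha>)\<close>. The bias is therefore at most \<open>exp (- \<rho> / h powr \<alpha>)\<close> times the tail of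
the integral that defines \<open>C\<close>. As a fraction of \<open>C\<close> this tail tends to 0 with \<open>h\<close>, and it is less than 1
because a characteristic function does not vanish near the origin (\<open>exists_tail_factor\<close>).
\<close>

section \<open>Fourier integrals and their derivatives\<close>

definition fourier_integral :: "(real \<Rightarrow> complex) \<Rightarrow> real \<Rightarrow> complex" where
  "fourier_integral G x = (CLINT t|lborel. iexp (- (t * x)) * G t)"

lemma integrable_iexp_mult:
  assumes "integrable lborel G"
  shows "integrable lborel (\<lambda>t. iexp (- (t * x)) * G t)"
proof (rule Bochner_Integration.integrable_bound[OF assms])
  show "(\<lambda>t. iexp (- (t * x)) * G t) \<in> borel_measurable lborel"
    using borel_measurable_integrable[OF assms] by measurable
  show "AE t in lborel. norm (iexp (- (t * x)) * G t) \<le> norm (G t)"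
    by (simp add: norm_mult del: of_real_mult of_real_minus)
qed

lemma fourier_integral_measurable [measurable]:
  assumes [measurable]: "G \<in> borel_measurable borel"
  shows "fourier_integral G \<in> borel_measurable borel"
  unfolding fourier_integral_def by measurable

lemma fourier_integral_diff:
  assumes "integrable lborel G" "integrable lborel H"
  shows "fourier_integral (\<lambda>t. G t - H t) x = fourier_integral G x - fourier_integral H x"
  unfolding fourier_integral_def right_diff_distrib
  by (intro Bochner_Integration.integral_diff integrable_iexp_mult assms)

lemma isCont_fourier_integral:
  assumes G: "integrable lborel G"
  shows "isCont (fourier_integral G) x"
  unfolding continuous_at_sequentially
proof safe
  fix X assume X: "X \<longlonglongrightarrow> x"
  have [measurable]: "G \<in> borel_measurable borel"
    using borel_measurable_integrable[OF G] by simp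
  show "(fourier_integral G \<circ> X) \<longlonglongrightarrow> fourier_integral G x"
    unfolding comp_def fourier_integral_def
    by (rule integral_dominated_convergence[where w="\<lambda>t. norm (G t)"])
       (auto intro!: tendsto_intros X G simp: norm_mult simp del: of_real_mult of_real_minus)
qed

lemma tendsto_iexp_difference_quotient:
  assumes "X \<longlonglongrightarrow> 0" "\<And>i. X i \<noteq> 0"
  shows "(\<lambda>i. (iexp (- (t * (x + X i))) - iexp (- (t * x))) / X i)
           \<longlonglongrightarrow> iexp (- (t * x)) * (- (\<i> * t))"
proof -
  let ?g = "\<lambda>z::complex. exp (- (\<i> * t * z))"
  have "(?g has_field_derivative ?g x * (- (\<i> * t))) (at (of_real x))"
    by (auto intro!: derivative_eq_intros)
  then have "(\<lambda>z::complex. (?g (x + z) - ?g x) / z) \<midarrow>0\<rightarrow> ?g x * (- (\<i> * t))"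
    by (simp add: DERIV_def)
  moreover have "filterlim (\<lambda>i. complex_of_real (X i)) (at 0) sequentially"
    using assms by (auto simp: filterlim_at intro!: tendsto_eq_intros)
  ultimately have "(\<lambda>i. (?g (of_real x + of_real (X i)) - ?g x) / of_real (X i)) \<longlonglongrightarrow> ?g x * (- (\<i> * t))"
    by (rule filterlim_compose)
  then show ?thesis by (simp add: mult.assoc)
qed

text \<open>Differentiation under the integral sign: the difference quotient of \<open>x \<mapsto> iexp (- (t * x))\<close> is
bounded by \<open>\<bar>t\<bar>\<close>, so \<open>\<lambda>t. cmod (t * G t)\<close> dominates. Only the real part is differentiated because
the iterated \<open>deriv\<close> of the estimator and of the density are taken on real functions.\<close>

lemma has_real_derivative_Re_fourier_integral:
  assumes G: "integrable lborel G" and tG: "integrable lborel (\<lambda>t. of_real t * G t)"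
  shows "((\<lambda>x. Re (fourier_integral G x)) has_real_derivative
      Re (fourier_integral (\<lambda>t. - (\<i> * t) * G t) x)) (at x)"
  unfolding DERIV_def tendsto_at_iff_sequentially
proof (intro allI impI)
  fix X :: "nat \<Rightarrow> real" assume "\<forall>i. X i \<in> UNIV - {0}" and X: "X \<longlonglongrightarrow> 0"
  then have X0: "X i \<noteq> 0" for i by auto
  have [measurable]: "G \<in> borel_measurable borel"
    using borel_measurable_integrable[OF G] by simp
  let ?q = "\<lambda>i t. (iexp (- (t * (x + X i))) - iexp (- (t * x))) / X i"
  have lim: "(\<lambda>i. CLINT t|lborel. ?q i t * G t)
      \<longlonglongrightarrow> (CLINT t|lborel. iexp (- (t * x)) * (- (\<i> * t) * G t))"
  proof (rule integral_dominated_convergence[where w="\<lambda>t. norm (of_real t * G t)"])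
    show "AE t in lborel. (\<lambda>i. ?q i t * G t) \<longlonglongrightarrow> iexp (- (t * x)) * (- (\<i> * t) * G t)"
    proof (rule AE_I2)
      fix t
      show "(\<lambda>i. ?q i t * G t) \<longlonglongrightarrow> iexp (- (t * x)) * (- (\<i> * t) * G t)"
        using tendsto_mult_right[OF tendsto_iexp_difference_quotient[OF X X0, of t x], of "G t"]
        by (simp add: mult.assoc)
    qed
    show "AE t in lborel. norm (?q i t * G t) \<le> norm (of_real t * G t)" for i
    proof (rule AE_I2)
      fix t
      have "iexp (- (t * (x + X i))) - iexp (- (t * x))
          = iexp (- (t * x)) * (iexp (- (t * X i)) - 1)"
        by (simp add: ring_distribs exp_add[symmetric] algebra_simps)
      then have "norm (iexp (- (t * (x + X i))) - iexp (- (t * x))) = norm (iexp (- (t * X i)) - 1)"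
        by (simp only: norm_mult norm_exp_i_times)
      also have "\<dots> \<le> \<bar>t\<bar> * \<bar>X i\<bar>"
        using iexp_approx1[of "- (t * X i)" 0] by (simp add: abs_mult)
      finally have "norm (?q i t) \<le> \<bar>t\<bar>"
        using X0[of i] by (simp only: norm_divide norm_of_real) (simp add: divide_simps)
      then show "norm (?q i t * G t) \<le> norm (of_real t * G t)"
        by (simp only: norm_mult norm_of_real) (rule mult_right_mono, auto)
    qed
  qed (use tG in auto)
  have eq: "(CLINT t|lborel. ?q i t * G t)
      = (fourier_integral G (x + X i) - fourier_integral G x) / X i" for i
  proof -
    have "(CLINT t|lborel. ?q i t * G t)
        = (CLINT t|lborel. (iexp (- (t * (x + X i))) * G t - iexp (- (t * x)) * G t) / X i)"
      by (rule Bochner_Integration.integral_cong) (simp_all add: field_simps)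
    also have "\<dots> = (fourier_integral G (x + X i) - fourier_integral G x) / X i"
      unfolding fourier_integral_def
      by (subst Bochner_Integration.integral_divide_zero, subst Bochner_Integration.integral_diff)
         (auto intro!: integrable_iexp_mult G simp del: of_real_mult of_real_minus of_real_add)
    finally show ?thesis .
  qed
  show "((\<lambda>h. (Re (fourier_integral G (x + h)) - Re (fourier_integral G x)) / h) \<circ> X)
      \<longlonglongrightarrow> Re (fourier_integral (\<lambda>t. - (\<i> * t) * G t) x)"
    using tendsto_Re[OF lim] unfolding eq fourier_integral_def[of "\<lambda>t. - (\<i> * t) * G t" x]
    by (simp add: comp_def)
qed

lemma funpow_deriv_Re_fourier_integral:
  assumes "\<And>j. j \<le> k \<Longrightarrow> integrable lborel (\<lambda>t. of_real (t ^ j) * G t)"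
  shows "(deriv ^^ k) (\<lambda>x. Re (fourier_integral G x))
    = (\<lambda>x. Re (fourier_integral (\<lambda>t. (- (\<i> * t)) ^ k * G t) x))"
  using assms
proof (induction k)
  case (Suc k)
  let ?H = "\<lambda>t. (- (\<i> * complex_of_real t)) ^ k * G t"
  have "integrable lborel (\<lambda>t. (- \<i>) ^ k * (of_real (t ^ k) * G t))"
    by (intro integrable_mult_right Suc.prems) simp
  then have H: "integrable lborel ?H"
    by (rule back_subst[of "integrable lborel"]) (auto simp: power_mult_distrib fun_eq_iff power_minus[of "\<i> * _"] power_minus[of \<i>])
  have "integrable lborel (\<lambda>t. (- \<i>) ^ k * (of_real (t ^ Suc k) * G t))"
    by (intro integrable_mult_right Suc.prems) simp
  then have tH: "integrable lborel (\<lambda>t. of_real t * ?H t)"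
    by (rule back_subst[of "integrable lborel"]) (auto simp: power_mult_distrib fun_eq_iff power_minus[of "\<i> * _"] power_minus[of \<i>])
  have "deriv (\<lambda>x. Re (fourier_integral ?H x)) x
      = Re (fourier_integral (\<lambda>t. - (\<i> * t) * ?H t) x)" for x
    by (rule DERIV_imp_deriv has_real_derivative_Re_fourier_integral H tH)+
  then show ?case
    using Suc by (simp add: mult.assoc)
qed simp

section \<open>A Plancherel inequality\<close>

text \<open>The duality of the Fourier integral, from Fubini's theorem. It is used with a probability
measure and \<open>H\<close> bounded for the Plancherel inequality, and with Lebesgue measure and \<open>H\<close> the
indicator of an interval for the inversion formula.\<close>

lemma integral_mult_fourier_integral:
  fixes H :: "real \<Rightarrow> complex"
  assumes N: "sigma_finite_measure N" and sets_N [measurable_cong]: "sets N = sets borel"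
    and G: "integrable lborel G" and H: "integrable N H"
  shows "(CLINT x|N. H x * fourier_integral G x)
    = (CLINT t|lborel. G t * (CLINT x|N. iexp (- (t * x)) * H x))"
proof -
  interpret N: sigma_finite_measure N by fact
  interpret LN: pair_sigma_finite lborel N ..
  have [measurable]: "G \<in> borel_measurable borel" "H \<in> borel_measurable borel"
    using borel_measurable_integrable[OF G] borel_measurable_integrable[OF H] by measurable
  let ?f = "\<lambda>t x. H x * (iexp (- (t * x)) * G t)"
  have norm_f: "cmod (?f t x) = cmod (H x) * cmod (G t)" for t x
    by (simp only: norm_mult norm_exp_i_times mult_1)
  have "integrable (lborel \<Otimes>\<^sub>M N) (case_prod ?f)"
  proof (rule LN.Fubini_integrable)
    show "case_prod ?f \<in> borel_measurable (lborel \<Otimes>\<^sub>M N)" by measurable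
    show "integrable lborel (\<lambda>t. LINT x|N. cmod (case (t, x) of (t, x) \<Rightarrow> ?f t x))"
      unfolding split norm_f using G by simp
    show "AE t in lborel. integrable N (\<lambda>x. case (t, x) of (t, x) \<Rightarrow> ?f t x)"
    proof (rule AE_I2)
      fix t
      show "integrable N (\<lambda>x. case (t, x) of (t, x) \<Rightarrow> ?f t x)"
        by (rule Bochner_Integration.integrable_bound[where f="\<lambda>x. G t * H x"])
           (auto simp: H norm_mult mult.commute simp del: of_real_mult of_real_minus)
    qed
  qed
  then have "(CLINT x|N. CLINT t|lborel. ?f t x) = (CLINT t|lborel. CLINT x|N. ?f t x)"
    by (rule LN.Fubini_integral)
  also have "(CLINT t|lborel. CLINT x|N. ?f t x)
      = (CLINT t|lborel. CLINT x|N. G t * (iexp (- (t * x)) * H x))"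
    by (simp add: mult_ac)
  finally show ?thesis by (simp add: fourier_integral_def)
qed

text \<open>Expanding both factors of \<open>cmod (fourier_integral G x)\<^sup>2\<close> and integrating in \<open>x\<close> first gives
\<open>\<integral>\<integral> G t * cnj (G s) * char N (s - t)\<close>. Schur's test, that is
\<open>a * b \<le> (a\<^sup>2 + b\<^sup>2) / 2\<close> under the convolution kernel \<open>cmod (char N (t - s))\<close>, then bounds the
double integral.\<close>

lemma nn_integral_fourier_integral_le:
  assumes N: "real_distribution N" and G: "integrable lborel G"
  shows "(\<integral>\<^sup>+ x. ennreal ((cmod (fourier_integral G x))\<^sup>2) \<partial>N)
    \<le> (\<integral>\<^sup>+ t. ennreal ((cmod (G t))\<^sup>2) \<partial>lborel) * (\<integral>\<^sup>+ u. ennreal (cmod (char N u)) \<partial>lborel)"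
proof -
  interpret N: real_distribution N by fact
  have [measurable]: "G \<in> borel_measurable borel"
    using borel_measurable_integrable[OF G] by simp
  let ?F = "fourier_integral G" and ?I = "LINT t|lborel. cmod (G t)"
  let ?c = "\<lambda>t s. ennreal (cmod (char N (t - s)))"
  have bdd: "cmod (?F x) \<le> ?I" for x
    unfolding fourier_integral_def
    by (rule order_trans[OF integral_norm_bound])
       (simp add: norm_mult del: of_real_mult of_real_minus)
  have Fsq: "complex_of_real ((cmod (?F x))\<^sup>2) = cnj (?F x) * ?F x" for x
    by (simp add: complex_norm_square mult.commute del: of_real_power)
  have cnj_meas [measurable]: "(\<lambda>x. cnj (?F x)) \<in> borel_measurable borel"
    by (rule measurable_compose[OF _ borel_measurable_continuous_onI[OF continuous_on_cnj[OF continuous_on_id]]])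
       measurable
  have inner: "(CLINT x|N. iexp (- (t * x)) * cnj (?F x))
      = cnj (CLINT s|lborel. G s * char N (t - s))" for t
  proof -
    have "(CLINT x|N. iexp (- (t * x)) * cnj (?F x)) = cnj (CLINT x|N. iexp (t * x) * ?F x)"
      by (subst Bochner_Integration.integral_cnj[symmetric]) (simp add: exp_cnj)
    also have "(CLINT x|N. iexp (t * x) * ?F x)
        = (CLINT s|lborel. G s * (CLINT x|N. iexp (- (s * x)) * iexp (t * x)))"
      by (rule integral_mult_fourier_integral[OF N.sigma_finite_measure_axioms _ G])
         (auto intro!: N.integrable_const_bound[where B=1])
    also have "\<dots> = (CLINT s|lborel. G s * char N (t - s))"
      by (simp add: char_def exp_add[symmetric] algebra_simps)
    finally show ?thesis .
  qed
  have conv_int: "integrable lborel (\<lambda>s. G s * char N (t - s))" for t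
    by (rule Bochner_Integration.integrable_bound[OF G])
       (auto simp: norm_mult intro!: mult_left_le N.cmod_char_le_1)
  have conv_bdd: "cmod (CLINT s|lborel. G s * char N (t - s)) \<le> ?I" for t
    by (rule order_trans[OF integral_norm_bound integral_mono])
       (auto simp: norm_mult conv_int G intro!: mult_left_le N.cmod_char_le_1 integrable_norm[OF conv_int, unfolded norm_mult])
  have conv_meas [measurable]: "(\<lambda>t. cnj (CLINT s|lborel. G s * char N (t - s))) \<in> borel_measurable borel"
    by (rule measurable_compose[OF _ borel_measurable_continuous_onI[OF continuous_on_cnj[OF continuous_on_id]]])
       measurable
  have outer_int: "integrable lborel (\<lambda>t. G t * cnj (CLINT s|lborel. G s * char N (t - s)))"
  proof (rule Bochner_Integration.integrable_bound[where f="\<lambda>t. ?I *\<^sub>R G t"])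
    show "AE t in lborel. norm (G t * cnj (CLINT s|lborel. G s * char N (t - s))) \<le> norm (?I *\<^sub>R G t)"
      by (intro AE_I2) (auto simp: norm_mult mult.commute[of "cmod (G _)"] intro!: mult_right_mono conv_bdd)
  qed (use G in auto)
  have "(\<integral>\<^sup>+ x. ennreal ((cmod (?F x))\<^sup>2) \<partial>N) = ennreal (LINT x|N. (cmod (?F x))\<^sup>2)"
    by (rule nn_integral_eq_integral, rule N.integrable_const_bound[where B="?I\<^sup>2"])
       (auto intro: power_mono bdd)
  also have "(LINT x|N. (cmod (?F x))\<^sup>2) = cmod (CLINT x|N. complex_of_real ((cmod (?F x))\<^sup>2))"
    unfolding integral_complex_of_real by simp
  also have "(CLINT x|N. complex_of_real ((cmod (?F x))\<^sup>2))
      = (CLINT t|lborel. G t * (CLINT x|N. iexp (- (t * x)) * cnj (?F x)))"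
    unfolding Fsq by (rule integral_mult_fourier_integral[OF N.sigma_finite_measure_axioms _ G])
      (auto intro!: N.integrable_const_bound[where B="?I"] simp: bdd)
  also have "\<dots> = (CLINT t|lborel. G t * cnj (CLINT s|lborel. G s * char N (t - s)))"
    unfolding inner ..
  also have "ennreal (cmod \<dots>)
      \<le> (\<integral>\<^sup>+ t. ennreal (cmod (G t * cnj (CLINT s|lborel. G s * char N (t - s)))) \<partial>lborel)"
    by (rule integral_norm_bound_ennreal[OF outer_int])
  also have "\<dots> \<le> (\<integral>\<^sup>+ t. \<integral>\<^sup>+ s. ennreal (cmod (G t)) * ennreal (cmod (G s)) * ?c t s \<partial>lborel \<partial>lborel)"
  proof (rule nn_integral_mono)
    fix t
    have "ennreal (cmod (CLINT s|lborel. G s * char N (t - s)))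
        \<le> (\<integral>\<^sup>+ s. ennreal (cmod (G s * char N (t - s))) \<partial>lborel)"
      by (rule integral_norm_bound_ennreal[OF conv_int])
    then have "ennreal (cmod (G t)) * ennreal (cmod (CLINT s|lborel. G s * char N (t - s)))
        \<le> ennreal (cmod (G t)) * (\<integral>\<^sup>+ s. ennreal (cmod (G s * char N (t - s))) \<partial>lborel)"
      by (rule mult_left_mono) simp
    then show "ennreal (cmod (G t * cnj (CLINT s|lborel. G s * char N (t - s))))
        \<le> (\<integral>\<^sup>+ s. ennreal (cmod (G t)) * ennreal (cmod (G s)) * ?c t s \<partial>lborel)"
      by (simp add: norm_mult ennreal_mult nn_integral_cmult mult.assoc)
  qed
  also have "\<dots> \<le> (\<integral>\<^sup>+ t. \<integral>\<^sup>+ s. (ennreal ((cmod (G t))\<^sup>2) * ?c t s + ennreal ((cmod (G s))\<^sup>2) * ?c t s) / 2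
      \<partial>lborel \<partial>lborel)"
  proof (intro nn_integral_mono)
    fix t s
    have "cmod (G t) * cmod (G s) \<le> ((cmod (G t))\<^sup>2 + (cmod (G s))\<^sup>2) / 2"
      using sum_squares_bound[of "cmod (G t)" "cmod (G s)"] by simp
    then have "cmod (G t) * cmod (G s) * cmod (char N (t - s))
        \<le> ((cmod (G t))\<^sup>2 + (cmod (G s))\<^sup>2) / 2 * cmod (char N (t - s))"
      by (rule mult_right_mono) simp
    also have "\<dots> = ((cmod (G t))\<^sup>2 * cmod (char N (t - s)) + (cmod (G s))\<^sup>2 * cmod (char N (t - s))) / 2"
      by (simp add: field_simps)
    finally show "ennreal (cmod (G t)) * ennreal (cmod (G s)) * ?c t s
        \<le> (ennreal ((cmod (G t))\<^sup>2) * ?c t s + ennreal ((cmod (G s))\<^sup>2) * ?c t s) / 2"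
      by (simp add: ennreal_mult[symmetric] ennreal_plus[symmetric] divide_ennreal
                    ennreal_numeral[symmetric] del: ennreal_plus ennreal_numeral)
  qed
  also have "\<dots> = ((\<integral>\<^sup>+ t. \<integral>\<^sup>+ s. ennreal ((cmod (G t))\<^sup>2) * ?c t s \<partial>lborel \<partial>lborel)
      + (\<integral>\<^sup>+ t. \<integral>\<^sup>+ s. ennreal ((cmod (G s))\<^sup>2) * ?c t s \<partial>lborel \<partial>lborel)) / 2"
    by (simp add: nn_integral_divide nn_integral_add)
  also have "(\<integral>\<^sup>+ t. \<integral>\<^sup>+ s. ennreal ((cmod (G t))\<^sup>2) * ?c t s \<partial>lborel \<partial>lborel)
      = (\<integral>\<^sup>+ t. ennreal ((cmod (G t))\<^sup>2) \<partial>lborel) * (\<integral>\<^sup>+ u. ennreal (cmod (char N u)) \<partial>lborel)"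
  proof -
    have "(\<integral>\<^sup>+ s. ?c t s \<partial>lborel) = (\<integral>\<^sup>+ u. ennreal (cmod (char N u)) \<partial>lborel)" for t
      using nn_integral_real_affine[of "\<lambda>u. ennreal (cmod (char N u))" "-1" t] by simp
    then show ?thesis by (simp add: nn_integral_cmult nn_integral_multc)
  qed
  also have "(\<integral>\<^sup>+ t. \<integral>\<^sup>+ s. ennreal ((cmod (G s))\<^sup>2) * ?c t s \<partial>lborel \<partial>lborel)
      = (\<integral>\<^sup>+ t. ennreal ((cmod (G t))\<^sup>2) \<partial>lborel) * (\<integral>\<^sup>+ u. ennreal (cmod (char N u)) \<partial>lborel)"
  proof -
    have "(\<integral>\<^sup>+ t. ?c t s \<partial>lborel) = (\<integral>\<^sup>+ u. ennreal (cmod (char N u)) \<partial>lborel)" for s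
      using nn_integral_real_affine[of "\<lambda>u. ennreal (cmod (char N u))" 1 "- s"] by simp
    then show ?thesis
      by (subst lborel_pair.Fubini') (simp_all add: nn_integral_cmult nn_integral_multc)
  qed
  also have "(a + a) / 2 = a" for a :: ennreal
    by (simp add: mult_2[symmetric] ennreal_times_divide[symmetric] mult_divide_eq_ennreal mult.commute)
  finally show ?thesis .
qed

lemma char_normal_density_0:
  assumes "\<sigma> > 0"
  shows "char (density lborel (normal_density 0 \<sigma>)) t = of_real (exp (- (\<sigma> * t)\<^sup>2 / 2))"
proof -
  interpret S: prob_space std_normal_distribution
    by (rule prob_space_normal_density) simp
  have "distributed std_normal_distribution lborel (\<lambda>x. x) std_normal_density"
    by (simp add: distributed_def distr_id2)
  from S.normal_density_affine[OF this, of \<sigma> 0]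
  have "distributed std_normal_distribution lborel (\<lambda>x. \<sigma> * x) (normal_density 0 \<sigma>)"
    using assms by simp
  then have "density lborel (normal_density 0 \<sigma>) = distr std_normal_distribution lborel (\<lambda>x. \<sigma> * x)"
    by (simp add: distributed_def)
  then have "char (density lborel (normal_density 0 \<sigma>)) t
      = (CLINT x|std_normal_distribution. iexp (t * (\<sigma> * x)))"
    unfolding char_def by (simp add: integral_distr)
  also have "\<dots> = char std_normal_distribution (\<sigma> * t)"
    by (simp add: char_def mult_ac)
  finally show ?thesis by (simp add: char_std_normal_distribution)
qed

text \<open>Only this direction of Plancherel's identity is needed for an upper bound on the error, and it
follows without any approximate identity. The preceding bound is applied to the normal law of
standard deviation \<open>s\<close>: the mass of its characteristic function is \<open>sqrt (2 * pi) / s\<close>, which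
exactly compensates the height \<open>1 / (sqrt (2 * pi) * s)\<close> of its density. As \<open>s\<close> grows the
rescaled density increases to 1, and Fatou's lemma removes it.\<close>

lemma plancherel_le:
  assumes G: "integrable lborel G"
  shows "(\<integral>\<^sup>+ x. ennreal ((cmod (fourier_integral G x))\<^sup>2) \<partial>lborel)
    \<le> ennreal (2 * pi) * (\<integral>\<^sup>+ t. ennreal ((cmod (G t))\<^sup>2) \<partial>lborel)"
proof -
  have [measurable]: "G \<in> borel_measurable borel"
    using borel_measurable_integrable[OF G] by simp
  let ?F = "fourier_integral G" and ?J = "\<integral>\<^sup>+ t. ennreal ((cmod (G t))\<^sup>2) \<partial>lborel"
  \<comment> \<open>The normal density of standard deviation \<open>n + 1\<close>, rescaled to have height 1.\<close>
  define w where "w n x = exp (- (x / real (Suc n))\<^sup>2 / 2)" for n x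
  have w_meas [measurable]: "w n \<in> borel_measurable borel" for n
    unfolding w_def by measurable
  have weighted: "(\<integral>\<^sup>+ x. ennreal ((cmod (?F x))\<^sup>2 * w n x) \<partial>lborel) \<le> ennreal (2 * pi) * ?J" for n
  proof -
    define s where "s = real (Suc n)"
    have s: "s > 0" by (simp add: s_def)
    let ?N = "density lborel (normal_density 0 s)"
    have N: "real_distribution ?N"
      using prob_space_normal_density[OF s, of 0] by (simp add: real_distribution_def real_distribution_axioms_def)
    have w_eq: "w n x = sqrt (2 * pi) * s * normal_density 0 s x" for x
      unfolding w_def s_def[symmetric] using s by (simp add: normal_density_def real_sqrt_mult power_divide)
    have "cmod (char ?N u) = sqrt (2 * pi) / s * normal_density 0 (1 / s) u" for u
      unfolding char_normal_density_0[OF s] using s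
      by (simp add: normal_density_def real_sqrt_mult real_sqrt_divide power_mult_distrib power_divide)
    then have char_int: "(\<integral>\<^sup>+ u. ennreal (cmod (char ?N u)) \<partial>lborel) = ennreal (sqrt (2 * pi) / s)"
      using s by (subst nn_integral_eq_integral) auto
    have "(\<integral>\<^sup>+ x. ennreal ((cmod (?F x))\<^sup>2 * w n x) \<partial>lborel)
        = (\<integral>\<^sup>+ x. ennreal (sqrt (2 * pi) * s) * (ennreal (normal_density 0 s x) * ennreal ((cmod (?F x))\<^sup>2)) \<partial>lborel)"
      using s by (intro nn_integral_cong) (simp add: w_eq ennreal_mult[symmetric] mult_ac)
    also have "\<dots> = ennreal (sqrt (2 * pi) * s) * (\<integral>\<^sup>+ x. ennreal ((cmod (?F x))\<^sup>2) \<partial>?N)"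
      by (simp add: nn_integral_cmult nn_integral_density)
    also have "\<dots> \<le> ennreal (sqrt (2 * pi) * s) * (?J * ennreal (sqrt (2 * pi) / s))"
      by (intro mult_left_mono order_trans[OF nn_integral_fourier_integral_le[OF N G]])
         (simp_all add: char_int)
    also have "\<dots> = ennreal (sqrt (2 * pi) * s * (sqrt (2 * pi) / s)) * ?J"
      using s by (subst ennreal_mult) (auto simp: mult_ac)
    also have "sqrt (2 * pi) * s * (sqrt (2 * pi) / s) = 2 * pi"
      using s by simp
    finally show ?thesis .
  qed
  have "ennreal ((cmod (?F x))\<^sup>2) = liminf (\<lambda>n. ennreal ((cmod (?F x))\<^sup>2 * w n x))" for x
  proof -
    have "(\<lambda>n. x / real (Suc n)) \<longlonglongrightarrow> 0"
      using LIMSEQ_Suc[OF lim_const_over_n[of x]] by simp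
    then have "(\<lambda>n. w n x) \<longlonglongrightarrow> exp (- 0\<^sup>2 / 2)"
      unfolding w_def by (intro tendsto_intros) auto
    then have "(\<lambda>n. (cmod (?F x))\<^sup>2 * w n x) \<longlonglongrightarrow> (cmod (?F x))\<^sup>2"
      using tendsto_mult_left[of "\<lambda>n. w n x" 1] by fastforce
    then show ?thesis
      by (intro lim_imp_Liminf[symmetric] tendsto_ennrealI) auto
  qed
  then have "(\<integral>\<^sup>+ x. ennreal ((cmod (?F x))\<^sup>2) \<partial>lborel)
      = (\<integral>\<^sup>+ x. liminf (\<lambda>n. ennreal ((cmod (?F x))\<^sup>2 * w n x)) \<partial>lborel)"
    by simp
  also have "\<dots> \<le> liminf (\<lambda>n. \<integral>\<^sup>+ x. ennreal ((cmod (?F x))\<^sup>2 * w n x) \<partial>lborel)"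
    by (rule nn_integral_liminf) measurable
  also have "\<dots> \<le> liminf (\<lambda>n::nat. ennreal (2 * pi) * ?J)"
    by (intro Liminf_mono always_eventually allI weighted)
  finally show ?thesis by (simp add: Liminf_const)
qed

section \<open>Fourier inversion for densities\<close>

lemma integrable_complex_indicator_Icc:
  "integrable lborel (\<lambda>t. indicator {a..b::real} t :: complex)"
proof -
  have "integrable lborel (\<lambda>t. complex_of_real (indicator {a..b} t))"
    by (intro integrable_of_real integrable_real_indicator) (auto simp: emeasure_lborel_Icc_eq)
  then show ?thesis by (simp add: of_real_indicator)
qed

lemma integral_iexp_interval:
  fixes t :: real
  assumes "a \<le> b" "t \<noteq> 0"
  shows "(CLINT x|lborel. iexp (- (t * x)) * indicator {a..b} x)
    = (iexp (- (t * a)) - iexp (- (t * b))) / (\<i> * t)"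
proof -
  let ?P = "\<lambda>x. \<i> / t * iexp (- (t * x))"
  have "(CLINT x|lborel. indicator {a..b} x *\<^sub>R iexp (- (t * x))) = ?P b - ?P a"
  proof (rule integral_FTC_atLeastAtMost[OF \<open>a \<le> b\<close>])
    fix x
    have "(?P has_vector_derivative \<i> / t * ((- t) *\<^sub>R (\<i> * iexp (- (t * x))))) (at x within {a..b})"
      by (rule has_vector_derivative_mult_right)
         (rule vector_diff_chain_within[where g=iexp and f="\<lambda>x. - (t * x)", unfolded comp_def],
          auto intro!: derivative_eq_intros simp del: of_real_mult of_real_minus)
    then show "(?P has_vector_derivative iexp (- (t * x))) (at x within {a..b})"
      using assms by (simp add: scaleR_conv_of_real)
  qed (auto intro!: continuous_intros)
  also have "\<dots> = (iexp (- (t * a)) - iexp (- (t * b))) / (\<i> * t)"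
    using assms by (simp add: field_simps)
  finally show ?thesis
    by (simp add: scaleR_conv_of_real mult.commute of_real_indicator)
qed

text \<open>Levy's inversion formula expresses the left side as a limit of truncated integrals. For an
integrable characteristic function the limit is the integral over the whole line, whose kernel
is itself the integral of \<open>iexp (- (t * x))\<close> over \<open>x\<close> in the interval; duality exchanges the two
integrations.\<close>

lemma (in real_distribution) measure_interval_eq_integral_char:
  assumes ab: "a \<le> b" and null: "measure M {a} = 0" "measure M {b} = 0"
    and int: "integrable lborel (char M)"
  shows "measure M {a<..b}
    = (LINT x|lborel. indicator {a..b} x * (Re (fourier_integral (char M) x) / (2 * pi)))"
proof -
  let ?Q = "\<lambda>t. (iexp (- (t * a)) - iexp (- (t * b))) / (\<i> * t) * char M t"
  have Q_bound: "norm (?Q t) \<le> (b - a) * norm (char M t)" for t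
  proof (cases "t = 0")
    case False
    have "norm ((iexp (- (t * a)) - iexp (- (t * b))) / (\<i> * t)) \<le> b - a"
      using Levy_Inversion_aux2[of "- b" "- a" t] ab False by simp
    then show ?thesis
      unfolding norm_mult by (intro mult_right_mono) simp_all
  qed (use ab in simp)
  have Q_meas [measurable]: "?Q \<in> borel_measurable borel"
    by measurable
  have "(\<lambda>T. CLBINT t=-real T..real T. ?Q t) \<longlonglongrightarrow> (CLINT t|lborel. ?Q t)"
  proof -
    have "(\<lambda>T. CLINT t|lborel. indicator {-real T<..<real T} t *\<^sub>R ?Q t)
        \<longlonglongrightarrow> (CLINT t|lborel. ?Q t)"
    proof (rule integral_dominated_convergence[where w="\<lambda>t. (b - a) * norm (char M t)"])
      show "AE t in lborel. (\<lambda>T. indicator {-real T<..<real T} t *\<^sub>R ?Q t) \<longlonglongrightarrow> ?Q t"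
      proof (intro AE_I2 tendsto_eventually)
        fix t
        obtain n where "\<bar>t\<bar> < real n"
          using reals_Archimedean2 by blast
        then have n: "- real T < t \<and> t < real T" if "n \<le> T" for T
          using that by linarith
        show "\<forall>\<^sub>F T in sequentially. indicator {-real T<..<real T} t *\<^sub>R ?Q t = ?Q t"
          using eventually_ge_at_top[of n] by (rule eventually_mono) (simp add: n)
      qed
      show "AE t in lborel. norm (indicator {-real T<..<real T} t *\<^sub>R ?Q t) \<le> (b - a) * norm (char M t)" for T
        using Q_bound ab by (intro AE_I2) (auto simp: indicator_def)
      show "integrable lborel (\<lambda>t. (b - a) * norm (char M t))"
        using int by simp
    qed measurable
    then show ?thesis
      by (simp add: interval_lebesgue_integral_def set_lebesgue_integral_def)
  qed
  then have "(\<lambda>T. 1 / (2 * pi) * (CLBINT t=-real T..real T. ?Q t))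
      \<longlonglongrightarrow> 1 / (2 * pi) * (CLINT t|lborel. ?Q t)"
    by (rule tendsto_mult_left)
  then have "of_real (measure M {a<..b}) = 1 / (2 * pi) * (CLINT t|lborel. ?Q t)"
    using Levy_Inversion[OF ab null] by (auto intro: LIMSEQ_unique)
  also have "(CLINT t|lborel. ?Q t)
      = (CLINT t|lborel. char M t * (CLINT x|lborel. iexp (- (t * x)) * indicator {a..b} x))"
  proof (rule integral_cong_AE)
    show "AE t in lborel. ?Q t
        = char M t * (CLINT x|lborel. iexp (- (t * x)) * indicator {a..b} x)"
      using AE_lborel_singleton[of 0]
      by eventually_elim (subst integral_iexp_interval[OF ab], assumption, rule mult.commute)
  qed measurable
  also have "\<dots> = (CLINT x|lborel. indicator {a..b} x * fourier_integral (char M) x)"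
    by (rule integral_mult_fourier_integral[symmetric])
       (auto simp: int lborel.sigma_finite_measure_axioms integrable_complex_indicator_Icc)
  finally have "measure M {a<..b}
      = Re (1 / (2 * pi) * (CLINT x|lborel. indicator {a..b} x * fourier_integral (char M) x))"
    by (metis Re_complex_of_real)
  also have "\<dots> = 1 / (2 * pi) * Re (CLINT x|lborel. indicator {a..b} x * fourier_integral (char M) x)"
    by (simp add: Re_divide_of_real[of _ "2 * pi", simplified])
  also have "Re (CLINT x|lborel. indicator {a..b} x * fourier_integral (char M) x)
      = (LINT x|lborel. Re (indicator {a..b} x * fourier_integral (char M) x))"
  proof (rule integral_Re[symmetric])
    have "set_integrable lborel {a..b} (fourier_integral (char M))"
      by (rule borel_integrable_atLeastAtMost') 
         (auto intro!: continuous_at_imp_continuous_on isCont_fourier_integral int)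
    then show "integrable lborel (\<lambda>x. indicator {a..b} x * fourier_integral (char M) x)"
      by (simp add: set_integrable_def scaleR_conv_of_real of_real_indicator)
  qed
  also have "1 / (2 * pi) * \<dots>
      = (LINT x|lborel. 1 / (2 * pi) * Re (indicator {a..b} x * fourier_integral (char M) x))"
    by simp
  also have "\<dots> = (LINT x|lborel. indicator {a..b} x * (Re (fourier_integral (char M) x) / (2 * pi)))"
    by (rule Bochner_Integration.integral_cong) (auto simp: indicator_def)
  finally show ?thesis .
qed

lemma real_distribution_prob_density:
  assumes "prob_density f"
  shows "real_distribution (density lborel (\<lambda>x. ennreal (f x)))"
proof -
  have "prob_space (density lborel (\<lambda>x. ennreal (f x)))"
    by (rule prob_spaceI) (use assms in \<open>simp add: emeasure_density prob_density_def\<close>)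
  then show ?thesis
    by (simp add: real_distribution_def real_distribution_axioms_def)
qed

text \<open>The inverted function \<open>F\<close> has the same integral as \<open>f\<close> over every interval. Being continuous, it
cannot be negative anywhere, so that it is the density of a measure; this measure agrees with
the law of density \<open>f\<close> on half-open intervals, and densities are unique up to null sets.\<close>

lemma density_eq_fourier_integral_char:
  assumes f: "prob_density f" and int: "integrable lborel (char_fun f)"
  shows "AE x in lborel. f x = Re (fourier_integral (char_fun f) x) / (2 * pi)"
proof -
  let ?M = "density lborel (\<lambda>x. ennreal (f x))"
  define F where "F x = Re (fourier_integral (char_fun f) x) / (2 * pi)" for x
  have f_meas [measurable]: "f \<in> borel_measurable borel" and f0: "\<And>x. 0 \<le> f x"
    using f by (auto simp: prob_density_def)
  interpret M: real_distribution ?M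
    by (rule real_distribution_prob_density[OF f])
  have null: "measure ?M {a} = 0" for a
  proof -
    have "absolutely_continuous lborel ?M"
      by (rule absolutely_continuousI_density) measurable
    moreover have "{a} \<in> null_sets lborel" by (simp add: null_sets_def)
    ultimately have "{a} \<in> null_sets ?M"
      unfolding absolutely_continuous_def by (rule subsetD)
    then show ?thesis by (rule measure_eq_0_null_sets)
  qed
  have F_cont: "isCont F x" for x
    unfolding F_def
    by (intro continuous_divide isCont_Re isCont_fourier_integral int continuous_const) simp
  then have [measurable]: "F \<in> borel_measurable borel"
    by (intro borel_measurable_continuous_onI continuous_at_imp_continuous_on) auto
  have F_int: "integrable lborel (\<lambda>x. indicator {a..b} x * F x)" for a b
    using borel_integrable_atLeastAtMost'[of a b F] F_cont
    by (auto simp: set_integrable_def continuous_at_imp_continuous_on)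
  have interval: "measure ?M {a<..b} = (LINT x|lborel. indicator {a..b} x * F x)" if "a \<le> b" for a b
    unfolding F_def char_fun_def
    using that null int by (intro M.measure_interval_eq_integral_char) (auto simp: char_fun_def)
  have F0: "0 \<le> F x" for x
  proof (rule ccontr)
    assume "\<not> 0 \<le> F x"
    then have Fx: "F x < F x / 2" "F x < 0" by auto
    obtain d where d: "d > 0" and d': "\<And>y. y \<noteq> x \<Longrightarrow> dist y x \<le> d \<Longrightarrow> F y < F x / 2"
      using order_tendstoD(2)[OF F_cont[unfolded continuous_at] Fx(1)]
      unfolding eventually_at_le by blast
    have Fy: "F y < F x / 2" if "dist y x \<le> d" for y
      using d'[of y] that Fx(1) by (cases "y = x") auto
    have "0 \<le> measure ?M {x - d<..x + d}" by simp
    also have "\<dots> = (LINT y|lborel. indicator {x - d..x + d} y * F y)"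
      using d by (intro interval) simp
    also have "\<dots> \<le> (LINT y|lborel. indicator {x - d..x + d} y * (F x / 2))"
    proof (rule integral_mono[OF F_int])
      show "indicator {x - d..x + d} y * F y \<le> indicator {x - d..x + d} y * (F x / 2)" for y
        using Fy[of y] by (fastforce simp: indicator_def dist_real_def abs_le_iff intro: less_imp_le)
    qed (intro integrable_mult_left integrable_real_indicator; simp add: emeasure_lborel_Icc_eq)
    also have "\<dots> = 2 * d * (F x / 2)"
      using d by simp
    also have "\<dots> < 0"
      using d Fx by (simp add: mult_pos_neg)
    finally show False by simp
  qed
  have "?M = density lborel (\<lambda>x. ennreal (F x))"
  proof (rule measure_eqI_generator_eq[where \<Omega>=UNIV and E="range (\<lambda>(a, b). {a<..b::real})"
        and A="\<lambda>i. {- real i<..real i}"])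
    show "Int_stable (range (\<lambda>(a, b). {a<..b::real}))"
      by (auto simp: Int_stable_def)
    show "sets ?M = sigma_sets UNIV (range (\<lambda>(a, b). {a<..b::real}))"
      "sets (density lborel (\<lambda>x. ennreal (F x))) = sigma_sets UNIV (range (\<lambda>(a, b). {a<..b::real}))"
      by (simp_all add: borel_sigma_sets_Ioc)
    show "(\<Union>i. {- real i<..real i}) = UNIV"
    proof -
      have "x \<in> (\<Union>i. {- real i<..real i})" for x
      proof -
        obtain n where "\<bar>x\<bar> < real n"
          using reals_Archimedean2 by blast
        then show ?thesis by (intro UN_I[of n]) auto
      qed
      then show ?thesis by blast
    qed
    show "emeasure ?M {- real i<..real i} \<noteq> \<infinity>" for i
      by simp
    fix X assume "X \<in> range (\<lambda>(a, b). {a<..b::real})"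
    then obtain a b where X: "X = {a<..b}" by auto
    show "emeasure ?M X = emeasure (density lborel (\<lambda>x. ennreal (F x))) X"
    proof (cases "a \<le> b")
      case True
      have "emeasure ?M X = ennreal (LINT x|lborel. indicator {a..b} x * F x)"
        by (simp only: X M.emeasure_eq_measure interval[OF True])
      also have "\<dots> = (\<integral>\<^sup>+ x. ennreal (indicator {a..b} x * F x) \<partial>lborel)"
        by (rule nn_integral_eq_integral[OF F_int, symmetric]) (simp add: F0)
      also have "\<dots> = (\<integral>\<^sup>+ x. ennreal (F x) * indicator {a<..b} x \<partial>lborel)"
        by (rule nn_integral_cong_AE) (auto intro!: AE_I[of _ _ "{a}"] simp: indicator_def)
      finally show ?thesis by (simp add: X emeasure_density)
    qed (simp add: X)
  qed auto
  then have "AE x in lborel. ennreal (f x) = ennreal (F x)"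
    by (subst (asm) sigma_finite_measure.density_unique_iff[OF lborel.sigma_finite_measure_axioms]) auto
  then show ?thesis
    by eventually_elim (simp add: f0 F0 F_def[symmetric])
qed

lemma continuous_AE_eq_imp_eq:
  fixes f g :: "real \<Rightarrow> real"
  assumes ae: "AE x in lborel. f x = g x" and f: "\<And>x. isCont f x" and g: "\<And>x. isCont g x"
  shows "f = g"
proof (rule ext, rule ccontr)
  fix x assume "f x \<noteq> g x"
  then have "f x - g x \<noteq> 0" by simp
  moreover have "isCont (\<lambda>y. f y - g y) x"
    using f g by (intro continuous_intros)
  ultimately obtain d where d: "d > 0" "\<And>y. dist x y < d \<Longrightarrow> f y - g y \<noteq> 0"
    using continuous_at_avoid[of x "\<lambda>y. f y - g y" 0] by blast
  have "AE y in lborel. y \<notin> {x - d / 2..x + d / 2}"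
    using ae by eventually_elim (use d in \<open>fastforce simp: dist_real_def\<close>)
  then have "{x - d / 2..x + d / 2} \<in> null_sets lborel"
    by (subst (asm) AE_iff_null_sets[symmetric]) auto
  then show False
    using d(1) by (simp add: null_sets_def emeasure_lborel_Icc_eq)
qed

text \<open>For \<open>r > 0\<close> the density is continuous, hence equal to its inversion integral at every point, and
the two functions have the same derivatives. For \<open>r = 0\<close> a density is determined only almost
everywhere, which is why the conclusion has an exceptional null set.\<close>

lemma funpow_deriv_density:
  assumes f: "prob_density f" and diff: "times_differentiable r f"
    and int: "\<And>j. j \<le> r \<Longrightarrow> integrable lborel (\<lambda>t. of_real (t ^ j) * char_fun f t)"
  shows "AE x in lborel. (deriv ^^ r) f x
    = Re (fourier_integral (\<lambda>t. (- (\<i> * t)) ^ r * (char_fun f t / (2 * pi))) x)"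
proof -
  let ?\<Phi> = "\<lambda>t. char_fun f t / (2 * pi)"
  define F where "F = (\<lambda>x. Re (fourier_integral ?\<Phi> x))"
  have int0: "integrable lborel (char_fun f)"
    using int[of 0] by simp
  have \<Phi>_int: "integrable lborel ?\<Phi>"
    using int0 by simp
  have scale: "fourier_integral ?\<Phi> x = fourier_integral (char_fun f) x / (2 * pi)" for x
    unfolding fourier_integral_def times_divide_eq_right by (rule integral_divide_zero)
  have F_eq: "F x = Re (fourier_integral (char_fun f) x) / (2 * pi)" for x
    unfolding F_def scale using Re_divide_of_real[of _ "2 * pi"] by simp
  have f_F: "AE x in lborel. f x = F x"
    unfolding F_eq by (rule density_eq_fourier_integral_char[OF f int0])
  have "(deriv ^^ r) F = (\<lambda>x. Re (fourier_integral (\<lambda>t. (- (\<i> * t)) ^ r * ?\<Phi> t) x))"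
    unfolding F_def
  proof (rule funpow_deriv_Re_fourier_integral)
    fix j assume "j \<le> r"
    have "integrable lborel (\<lambda>t. of_real (t ^ j) * char_fun f t / (2 * pi))"
      using int[OF \<open>j \<le> r\<close>] by simp
    then show "integrable lborel (\<lambda>t. of_real (t ^ j) * ?\<Phi> t)"
      by simp
  qed
  moreover have "AE x in lborel. (deriv ^^ r) f x = (deriv ^^ r) F x"
  proof (cases "r = 0")
    case False
    then have "f differentiable (at x)" for x
      using diff by (auto simp: times_differentiable_def dest: spec[of _ 0])
    then have "isCont f x" for x
      by (rule differentiable_imp_continuous_within)
    moreover have "isCont F x" for x
      unfolding F_def by (intro isCont_Re isCont_fourier_integral \<Phi>_int)
    ultimately have "f = F"
      by (rule continuous_AE_eq_imp_eq[OF f_F])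
    then show ?thesis by simp
  qed (use f_F in simp)
  ultimately show ?thesis by simp
qed

section \<open>The empirical characteristic function\<close>

text \<open>Bienayme's identity for independent centred variables: the mixed terms factor into products of
vanishing expectations.\<close>

lemma (in prob_space) expectation_sum_square:
  fixes Z :: "'i \<Rightarrow> 'a \<Rightarrow> real"
  assumes "finite I" "indep_vars (\<lambda>_. borel) Z I"
    and "\<And>i. i \<in> I \<Longrightarrow> integrable M (\<lambda>\<omega>. (Z i \<omega>)\<^sup>2)" "\<And>i. i \<in> I \<Longrightarrow> expectation (Z i) = 0"
  shows "integrable M (\<lambda>\<omega>. (\<Sum>i\<in>I. Z i \<omega>)\<^sup>2)"
    and "expectation (\<lambda>\<omega>. (\<Sum>i\<in>I. Z i \<omega>)\<^sup>2) = (\<Sum>i\<in>I. expectation (\<lambda>\<omega>. (Z i \<omega>)\<^sup>2))"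
proof -
  have "integrable M (\<lambda>\<omega>. (\<Sum>i\<in>I. Z i \<omega>)\<^sup>2) \<and>
      expectation (\<lambda>\<omega>. (\<Sum>i\<in>I. Z i \<omega>)\<^sup>2) = (\<Sum>i\<in>I. expectation (\<lambda>\<omega>. (Z i \<omega>)\<^sup>2))"
    using assms
  proof (induction I rule: finite_induct)
    case (insert x I)
    let ?S = "\<lambda>\<omega>. \<Sum>i\<in>I. Z i \<omega>"
    have meas: "Z i \<in> borel_measurable M" if "i \<in> insert x I" for i
      using insert.prems(1) that by (auto simp: indep_vars_def2)
    have Z_int: "integrable M (Z i)" if "i \<in> insert x I" for i
      by (rule square_integrable_imp_integrable[OF meas[OF that] insert.prems(2)[OF that]])
    have IH: "integrable M (\<lambda>\<omega>. (?S \<omega>)\<^sup>2)"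
      "expectation (\<lambda>\<omega>. (?S \<omega>)\<^sup>2) = (\<Sum>i\<in>I. expectation (\<lambda>\<omega>. (Z i \<omega>)\<^sup>2))"
      using insert.IH[OF indep_vars_subset[OF insert.prems(1) subset_insertI]] insert.prems(2,3)
      by blast+
    have ind: "indep_var borel (Z x) borel ?S"
      by (rule indep_vars_sum[OF insert.hyps(1,2) insert.prems(1)])
    have S_int: "integrable M ?S"
      by (rule Bochner_Integration.integrable_sum) (rule Z_int[OF insertI2])
    have cross_int: "integrable M (\<lambda>\<omega>. Z x \<omega> * ?S \<omega>)"
      by (rule indep_var_integrable[OF ind Z_int[OF insertI1] S_int])
    have cross: "expectation (\<lambda>\<omega>. Z x \<omega> * ?S \<omega>) = 0"
      unfolding indep_var_lebesgue_integral[OF ind Z_int[OF insertI1] S_int] insert.prems(3)[OF insertI1]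
      by (rule mult_zero_left)
    have expand: "(\<lambda>\<omega>. (\<Sum>i\<in>insert x I. Z i \<omega>)\<^sup>2)
        = (\<lambda>\<omega>. (Z x \<omega>)\<^sup>2 + (2 * (Z x \<omega> * ?S \<omega>) + (?S \<omega>)\<^sup>2))"
      unfolding sum.insert[OF insert.hyps(1,2)] power2_sum by (simp add: mult.assoc add_ac)
    have sq_int: "integrable M (\<lambda>\<omega>. (Z x \<omega>)\<^sup>2)"
      by (rule insert.prems(2)) simp
    have rest_int: "integrable M (\<lambda>\<omega>. 2 * (Z x \<omega> * ?S \<omega>) + (?S \<omega>)\<^sup>2)"
      by (rule Bochner_Integration.integrable_add[OF integrable_mult_right[OF cross_int] IH(1)])
    have "expectation (\<lambda>\<omega>. 2 * (Z x \<omega> * ?S \<omega>) + (?S \<omega>)\<^sup>2) = expectation (\<lambda>\<omega>. (?S \<omega>)\<^sup>2)"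
      unfolding Bochner_Integration.integral_add[OF integrable_mult_right[OF cross_int] IH(1)]
        integral_mult_right_zero cross by simp
    then show ?case
      unfolding expand unfolding sum.insert[OF insert.hyps(1,2)] IH(2)[symmetric]
        Bochner_Integration.integral_add[OF sq_int rest_int]
      using Bochner_Integration.integrable_add[OF sq_int rest_int] by simp
  qed simp
  then show "integrable M (\<lambda>\<omega>. (\<Sum>i\<in>I. Z i \<omega>)\<^sup>2)"
    and "expectation (\<lambda>\<omega>. (\<Sum>i\<in>I. Z i \<omega>)\<^sup>2) = (\<Sum>i\<in>I. expectation (\<lambda>\<omega>. (Z i \<omega>)\<^sup>2))"
    by auto
qed

definition empirical_char :: "nat \<Rightarrow> (nat \<Rightarrow> real) \<Rightarrow> real \<Rightarrow> complex" where
  "empirical_char n xs t = (\<Sum>j=1..n. iexp (t * xs j)) / of_nat n"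

lemma continuous_empirical_char: "continuous_on S (empirical_char n xs)"
  unfolding empirical_char_def by (cases "n = 0") (auto intro!: continuous_intros)

lemma char_fun_eq_expectation:
  assumes "iid_sample M n X f" "j \<in> {1..n}" and [measurable]: "f \<in> borel_measurable borel"
  shows "char_fun f t = (CLINT \<omega>|M. iexp (t * X j \<omega>))"
proof -
  have "distributed M lborel (X j) (\<lambda>x. ennreal (f x))"
    using assms by (auto simp: iid_sample_def)
  then have X [measurable]: "X j \<in> borel_measurable M"
    and distr: "density lborel (\<lambda>x. ennreal (f x)) = distr M lborel (X j)"
    by (auto simp: distributed_def)
  show ?thesis
    unfolding char_fun_def char_def distr by (rule integral_distr) measurable
qed

text \<open>The left side is the variance of a mean of \<open>n\<close> independent copies of \<open>iexp (t * X)\<close>. The variance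
of one copy is at most its second absolute moment, and that is 1.\<close>

lemma expectation_empirical_char_error_le:
  assumes iid: "iid_sample M n X f" and "n \<ge> 1" and f: "f \<in> borel_measurable borel"
  shows "(\<integral>\<^sup>+ \<omega>. ennreal ((cmod (empirical_char n (\<lambda>j. X j \<omega>) t - char_fun f t))\<^sup>2) \<partial>M)
    \<le> ennreal (1 / n)"
proof -
  interpret prob_space M
    using iid by (simp add: iid_sample_def)
  have indep: "indep_vars (\<lambda>_. borel) X {1..n}"
    using iid by (simp add: iid_sample_def)
  then have X_meas [measurable]: "j \<in> {1..n} \<Longrightarrow> X j \<in> borel_measurable M" for j
    by (auto simp: indep_vars_def2)
  let ?\<phi> = "char_fun f t"
  \<comment> \<open>Real and imaginary parts are treated alike: \<open>u\<close> is the cosine or the sine.\<close>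
  have part: "integrable M (\<lambda>\<omega>. (\<Sum>j=1..n. u (t * X j \<omega>) - m)\<^sup>2)"
    "expectation (\<lambda>\<omega>. (\<Sum>j=1..n. u (t * X j \<omega>) - m)\<^sup>2)
      \<le> (\<Sum>j=1..n. expectation (\<lambda>\<omega>. (u (t * X j \<omega>))\<^sup>2))"
    if u [measurable]: "u \<in> borel_measurable borel" and u1: "\<And>x. \<bar>u x\<bar> \<le> 1"
      and m: "\<And>j. j \<in> {1..n} \<Longrightarrow> expectation (\<lambda>\<omega>. u (t * X j \<omega>)) = m" for u :: "real \<Rightarrow> real" and m
  proof -
    let ?Z = "\<lambda>j \<omega>. u (t * X j \<omega>) - m"
    have ind: "indep_vars (\<lambda>_. borel) ?Z {1..n}"
      by (rule indep_vars_compose2[OF indep, where Y="\<lambda>_ x. u (t * x) - m"]) measurable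
    have u_int: "integrable M (\<lambda>\<omega>. u (t * X j \<omega>))" "integrable M (\<lambda>\<omega>. (u (t * X j \<omega>))\<^sup>2)"
      if "j \<in> {1..n}" for j
      using X_meas[OF that] u1
      by (auto intro!: integrable_const_bound[where B=1] simp: abs_square_le_1)
    have Z2: "(\<lambda>\<omega>. (?Z j \<omega>)\<^sup>2) = (\<lambda>\<omega>. (u (t * X j \<omega>))\<^sup>2 - (2 * m * u (t * X j \<omega>) - m\<^sup>2))" for j
      by (auto simp: power2_diff)
    have Z_int: "integrable M (\<lambda>\<omega>. (?Z j \<omega>)\<^sup>2)" if "j \<in> {1..n}" for j
      unfolding Z2 using u_int[OF that] by simp
    have Z0: "expectation (?Z j) = 0" if "j \<in> {1..n}" for j
      using u_int[OF that] m[OF that] by (simp add: prob_space)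
    show "integrable M (\<lambda>\<omega>. (\<Sum>j=1..n. ?Z j \<omega>)\<^sup>2)"
      by (rule expectation_sum_square(1)[OF _ ind Z_int Z0]) simp_all
    have "expectation (\<lambda>\<omega>. (\<Sum>j=1..n. ?Z j \<omega>)\<^sup>2) = (\<Sum>j=1..n. expectation (\<lambda>\<omega>. (?Z j \<omega>)\<^sup>2))"
      by (rule expectation_sum_square(2)[OF _ ind Z_int Z0]) simp_all
    also have "\<dots> \<le> (\<Sum>j=1..n. expectation (\<lambda>\<omega>. (u (t * X j \<omega>))\<^sup>2))"
    proof (rule sum_mono)
      fix j assume j: "j \<in> {1..n}"
      have "expectation (\<lambda>\<omega>. (?Z j \<omega>)\<^sup>2) = expectation (\<lambda>\<omega>. (u (t * X j \<omega>))\<^sup>2) - m\<^sup>2"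
        unfolding Z2 using u_int[OF j] m[OF j] by (simp add: prob_space power2_eq_square)
      then show "expectation (\<lambda>\<omega>. (?Z j \<omega>)\<^sup>2) \<le> expectation (\<lambda>\<omega>. (u (t * X j \<omega>))\<^sup>2)"
        by simp
    qed
    finally show "expectation (\<lambda>\<omega>. (\<Sum>j=1..n. ?Z j \<omega>)\<^sup>2)
      \<le> (\<Sum>j=1..n. expectation (\<lambda>\<omega>. (u (t * X j \<omega>))\<^sup>2))" .
  qed
  have iexp_int: "integrable M (\<lambda>\<omega>. iexp (t * X j \<omega>))" if "j \<in> {1..n}" for j
    using X_meas[OF that] by (intro integrable_const_bound[where B=1]) auto
  have cos_mean: "expectation (\<lambda>\<omega>. cos (t * X j \<omega>)) = Re ?\<phi>" if "j \<in> {1..n}" for j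
    using integral_Re[OF iexp_int[OF that]] char_fun_eq_expectation[OF iid that f, of t]
    by (simp add: Re_exp)
  have sin_mean: "expectation (\<lambda>\<omega>. sin (t * X j \<omega>)) = Im ?\<phi>" if "j \<in> {1..n}" for j
    using integral_Im[OF iexp_int[OF that]] char_fun_eq_expectation[OF iid that f, of t]
    by (simp add: Im_exp)
  let ?c = "\<lambda>\<omega>. (\<Sum>j=1..n. cos (t * X j \<omega>) - Re ?\<phi>)\<^sup>2"
  let ?s = "\<lambda>\<omega>. (\<Sum>j=1..n. sin (t * X j \<omega>) - Im ?\<phi>)\<^sup>2"
  have c: "integrable M ?c"
    "expectation ?c \<le> (\<Sum>j=1..n. expectation (\<lambda>\<omega>. (cos (t * X j \<omega>))\<^sup>2))"
    by (rule part[OF _ _ cos_mean]; simp)+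
  have s: "integrable M ?s"
    "expectation ?s \<le> (\<Sum>j=1..n. expectation (\<lambda>\<omega>. (sin (t * X j \<omega>))\<^sup>2))"
    by (rule part[OF _ _ sin_mean]; simp)+
  have err: "(cmod (empirical_char n (\<lambda>j. X j \<omega>) t - ?\<phi>))\<^sup>2 = (?c \<omega> + ?s \<omega>) / (real n)\<^sup>2" for \<omega>
  proof -
    have "empirical_char n (\<lambda>j. X j \<omega>) t - ?\<phi> = (\<Sum>j=1..n. iexp (t * X j \<omega>) - ?\<phi>) / of_nat n"
      using \<open>n \<ge> 1\<close> by (simp add: empirical_char_def sum_subtractf field_simps)
    then have "(cmod (empirical_char n (\<lambda>j. X j \<omega>) t - ?\<phi>))\<^sup>2
        = (cmod (\<Sum>j=1..n. iexp (t * X j \<omega>) - ?\<phi>))\<^sup>2 / (real n)\<^sup>2"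
      by (simp add: norm_divide power_divide)
    also have "(cmod (\<Sum>j=1..n. iexp (t * X j \<omega>) - ?\<phi>))\<^sup>2 = ?c \<omega> + ?s \<omega>"
      by (simp only: cmod_power2 Re_sum Im_sum minus_complex.sel Re_exp Im_exp) simp
    finally show ?thesis .
  qed
  have sq1: "expectation (\<lambda>\<omega>. (cos (t * X j \<omega>))\<^sup>2) + expectation (\<lambda>\<omega>. (sin (t * X j \<omega>))\<^sup>2) = 1"
    if "j \<in> {1..n}" for j
  proof -
    have "integrable M (\<lambda>\<omega>. (cos (t * X j \<omega>))\<^sup>2)" "integrable M (\<lambda>\<omega>. (sin (t * X j \<omega>))\<^sup>2)"
      using X_meas[OF that]
      by (auto intro!: integrable_const_bound[where B=1] simp: abs_square_le_1)
    then have "expectation (\<lambda>\<omega>. (cos (t * X j \<omega>))\<^sup>2) + expectation (\<lambda>\<omega>. (sin (t * X j \<omega>))\<^sup>2)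
        = expectation (\<lambda>\<omega>. (cos (t * X j \<omega>))\<^sup>2 + (sin (t * X j \<omega>))\<^sup>2)"
      by (rule Bochner_Integration.integral_add[symmetric])
    then show ?thesis by (simp add: prob_space)
  qed
  have "(\<integral>\<^sup>+ \<omega>. ennreal ((cmod (empirical_char n (\<lambda>j. X j \<omega>) t - ?\<phi>))\<^sup>2) \<partial>M)
      = ennreal (expectation (\<lambda>\<omega>. (?c \<omega> + ?s \<omega>) / (real n)\<^sup>2))"
    unfolding err using c(1) s(1) by (intro nn_integral_eq_integral) auto
  also have "expectation (\<lambda>\<omega>. (?c \<omega> + ?s \<omega>) / (real n)\<^sup>2) = (expectation ?c + expectation ?s) / (real n)\<^sup>2"
    using c(1) s(1) by simp
  also have "\<dots> \<le> (\<Sum>j=1..n. expectation (\<lambda>\<omega>. (cos (t * X j \<omega>))\<^sup>2)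
      + expectation (\<lambda>\<omega>. (sin (t * X j \<omega>))\<^sup>2)) / (real n)\<^sup>2"
    using c(2) s(2) unfolding sum.distrib by (intro divide_right_mono) auto
  also have "\<dots> = (\<Sum>j=1..n. 1) / (real n)\<^sup>2"
    by (simp only: sq1 cong: sum.cong)
  also have "\<dots> = 1 / n"
    by (simp add: power2_eq_square)
  finally show ?thesis by (simp add: ennreal_leI)
qed

section \<open>The sinc estimator as a truncated inversion integral\<close>

lemma sinc_kernel_eq_integral:
  assumes "h > 0"
  shows "(CLINT t|lborel. iexp (- (t * u)) * indicator {- (1 / h)..1 / h} t)
    = of_real (2 * pi / h * sinc_kernel (u / h))"
proof (cases "u = 0")
  case True
  have "(CLINT t|lborel. indicator {- (1 / h)..1 / h} t) = complex_of_real (2 / h)"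
    using assms integral_complex_of_real[of lborel "indicator {- (1 / h)..1 / h}"]
    by (simp add: of_real_indicator)
  with True assms show ?thesis
    by (simp add: sinc_kernel_def)
next
  case False
  have "(CLINT t|lborel. iexp (- (u * t)) * indicator {- (1 / h)..1 / h} t)
      = (iexp (u / h) - iexp (- (u / h))) / (\<i> * u)"
    using integral_iexp_interval[of "- (1 / h)" "1 / h" u] assms False by simp
  also have "\<dots> = of_real (2 * sin (u / h) / u)"
    using False by (simp add: complex_eq_iff Re_divide Im_divide Re_exp Im_exp power2_eq_square)
  also have "2 * sin (u / h) / u = 2 * pi / h * sinc_kernel (u / h)"
    using False assms by (simp add: sinc_kernel_def)
  finally show ?thesis by (simp add: mult.commute)
qed

text \<open>The sinc kernel is the inverse Fourier transform of the indicator of an interval, so the sinc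
estimator is the inversion integral of the empirical characteristic function cut off at
\<open>1 / h\<close>.\<close>

lemma sinc_estimator_eq_fourier_integral:
  assumes h: "h > 0"
  shows "sinc_estimator n h xs
    = (\<lambda>x. Re (fourier_integral (\<lambda>t. indicator {- (1 / h)..1 / h} t * empirical_char n xs t / (2 * pi)) x))"
proof
  fix x
  let ?I = "\<lambda>t. indicator {- (1 / h)..1 / h} t :: complex"
  have int: "integrable lborel (\<lambda>t. iexp (- (t * u)) * ?I t)" for u
    by (rule integrable_iexp_mult)
       (rule integrable_complex_indicator_Icc)
  have "iexp (- (t * x)) * (?I t * empirical_char n xs t / (2 * pi))
      = (\<Sum>j=1..n. iexp (- (t * (x - xs j))) * ?I t) / (2 * pi * n)" for t
  proof -
    have split: "iexp (- (t * (x - xs j))) = iexp (- (t * x)) * iexp (t * xs j)" for j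
      by (simp add: exp_add[symmetric] algebra_simps)
    show ?thesis
      unfolding split empirical_char_def sum_distrib_right[symmetric] sum_distrib_left[symmetric]
      by (simp add: mult_ac)
  qed
  then have "fourier_integral (\<lambda>t. ?I t * empirical_char n xs t / (2 * pi)) x
      = (CLINT t|lborel. (\<Sum>j=1..n. iexp (- (t * (x - xs j))) * ?I t) / (2 * pi * n))"
    unfolding fourier_integral_def by simp
  also have "\<dots> = (\<Sum>j=1..n. CLINT t|lborel. iexp (- (t * (x - xs j))) * ?I t) / (2 * pi * n)"
    by (subst Bochner_Integration.integral_divide_zero, subst Bochner_Integration.integral_sum)
       (auto intro: int simp del: of_real_mult of_real_minus of_real_diff)
  also have "\<dots> = of_real (sinc_estimator n h xs x)"
    unfolding sinc_kernel_eq_integral[OF h] sinc_estimator_def of_real_sum[symmetric] sum_distrib_left[symmetric]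
    using h by simp
  finally show "sinc_estimator n h xs x
      = Re (fourier_integral (\<lambda>t. ?I t * empirical_char n xs t / (2 * pi)) x)"
    by simp
qed

lemma funpow_deriv_sinc_estimator:
  fixes h :: real and r n :: nat and xs :: "nat \<Rightarrow> real"
  assumes "h > 0"
  defines "G \<equiv> \<lambda>t. (- (\<i> * t)) ^ r * (indicator {- (1 / h)..1 / h} t * empirical_char n xs t / (2 * pi))"
  shows "sinc_deriv_estimator r n h xs = (\<lambda>x. Re (fourier_integral G x))"
    and "integrable lborel G"
proof -
  let ?E = "\<lambda>t. indicator {- (1 / h)..1 / h} t * empirical_char n xs t / (2 * pi)"
  have int: "integrable lborel (\<lambda>t. c t * ?E t)" if "continuous_on UNIV c" for c :: "real \<Rightarrow> complex"
  proof -
    have "set_integrable lborel {- (1 / h)..1 / h} (\<lambda>t. c t * empirical_char n xs t / (2 * pi))"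
      using continuous_on_subset[OF that]
      by (intro borel_integrable_atLeastAtMost' continuous_intros continuous_empirical_char) auto
    then show ?thesis
      unfolding set_integrable_def
      by (rule back_subst[of "integrable lborel"]) (auto simp: indicator_def)
  qed
  show "integrable lborel G"
    unfolding G_def by (intro int continuous_intros)
  show "sinc_deriv_estimator r n h xs = (\<lambda>x. Re (fourier_integral G x))"
    unfolding sinc_deriv_estimator_def sinc_estimator_eq_fourier_integral[OF \<open>h > 0\<close>] G_def
    by (intro funpow_deriv_Re_fourier_integral int continuous_intros)
qed

section \<open>Integrability from the weighted moment condition\<close>

text \<open>For \<open>\<bar>t\<bar> > 1\<close> and \<open>s = \<rho> * \<bar>t\<bar> powr \<alpha>\<close>, the elementary bound \<open>(s / m) ^ m \<le> exp s\<close> with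
\<open>m > 2 / \<alpha>\<close> makes \<open>exp (- s)\<close> smaller than a constant multiple of \<open>1 / (1 + t\<^sup>2)\<close>.\<close>

lemma integrable_exp_neg_abs_powr:
  fixes \<rho> \<alpha> :: real
  assumes \<rho>: "\<rho> > 0" and \<alpha>: "\<alpha> > 0"
  shows "integrable lborel (\<lambda>t. exp (- (\<rho> * \<bar>t\<bar> powr \<alpha>)))"
proof -
  obtain m :: nat where "2 / \<alpha> < real m"
    using reals_Archimedean2 by blast
  with \<alpha> have m: "2 < \<alpha> * real m" "m > 0"
    by (auto simp: field_simps intro: gr0I)
  define K where "K = 2 + 2 * (real m / \<rho>) ^ m"
  have bound: "exp (- (\<rho> * \<bar>t\<bar> powr \<alpha>)) \<le> K * inverse (1 + t\<^sup>2)" for t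
  proof (cases "\<bar>t\<bar> \<le> 1")
    case True
    then have "t\<^sup>2 \<le> 1" by (simp add: abs_square_le_1)
    moreover have "0 \<le> (real m / \<rho>) ^ m"
      using \<rho> by simp
    ultimately have "1 + t\<^sup>2 \<le> K"
      unfolding K_def by linarith
    moreover have "exp (- (\<rho> * \<bar>t\<bar> powr \<alpha>)) \<le> 1"
      using \<rho> by simp
    moreover have "0 < 1 + t\<^sup>2"
      by (simp add: add_pos_nonneg)
    ultimately have "1 \<le> K / (1 + t\<^sup>2)"
      by (simp only: le_divide_eq_1_pos)
    then show ?thesis
      using \<open>exp (- (\<rho> * \<bar>t\<bar> powr \<alpha>)) \<le> 1\<close> unfolding divide_inverse by linarith
  next
    case False
    define s where "s = \<rho> * \<bar>t\<bar> powr \<alpha>"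
    have s: "s > 0" using \<rho> False by (simp add: s_def)
    have "t\<^sup>2 = \<bar>t\<bar> powr 2"
      using False by (simp add: powr_numeral)
    also have "\<dots> \<le> \<bar>t\<bar> powr (\<alpha> * real m)"
      using False m by (intro powr_mono) auto
    also have "\<dots> = (\<bar>t\<bar> powr \<alpha>) ^ m"
      using False by (simp add: powr_powr[symmetric] powr_realpow)
    also have "\<dots> = (s / \<rho>) ^ m"
      using \<rho> by (simp add: s_def)
    finally have t2: "t\<^sup>2 \<le> (s / \<rho>) ^ m" .
    have "s / real m \<le> exp (s / real m)"
      using exp_ge_add_one_self[of "s / real m"] by linarith
    then have "(s / real m) ^ m \<le> exp (s / real m) ^ m"
      using s by (intro power_mono) auto
    also have "\<dots> = exp s"
      using m by (simp add: exp_of_nat_mult[symmetric])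
    finally have es: "(s / real m) ^ m \<le> exp s" .
    have "t\<^sup>2 \<le> (real m / \<rho>) ^ m * (s / real m) ^ m"
      using t2 m by (simp add: power_mult_distrib[symmetric])
    also have "\<dots> \<le> (real m / \<rho>) ^ m * exp s"
      using es \<rho> by (intro mult_left_mono) auto
    finally have "t\<^sup>2 \<le> (real m / \<rho>) ^ m * exp s" .
    moreover have "1 + t\<^sup>2 \<le> 2 * t\<^sup>2"
      using False power_mono[of 1 "\<bar>t\<bar>" 2] by simp
    ultimately have "1 + t\<^sup>2 \<le> 2 * (real m / \<rho>) ^ m * exp s"
      by linarith
    also have "\<dots> \<le> K * exp s"
      by (intro mult_right_mono) (auto simp: K_def)
    finally have "1 + t\<^sup>2 \<le> K * exp s" .
    moreover have "0 < 1 + t\<^sup>2"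
      by (simp add: add_pos_nonneg)
    ultimately have "inverse (K * exp s) \<le> inverse (1 + t\<^sup>2)"
      by (rule le_imp_inverse_le)
    moreover have "K > 0"
      using \<rho> unfolding K_def by (intro add_pos_nonneg) auto
    ultimately show ?thesis
      unfolding s_def[symmetric] exp_minus inverse_mult_distrib
      by (simp add: field_simps)
  qed
  have "integrable lborel (\<lambda>t::real. inverse (1 + t\<^sup>2))"
    using integrable_inverse_1_plus_square by (simp add: set_integrable_def)
  then have "integrable lborel (\<lambda>t::real. K * inverse (1 + t\<^sup>2))"
    by simp
  then show ?thesis
    by (rule Bochner_Integration.integrable_bound)
       (measurable, rule AE_I2, use order_trans[OF bound abs_ge_self] in simp)
qed

text \<open>For \<open>\<bar>t\<bar> > 1\<close>, split \<open>\<bar>t\<bar> ^ r * cmod (char_fun f t)\<close> as the square root of the weighted square times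
\<open>exp (- (\<rho> * \<bar>t\<bar> powr \<alpha> / 2))\<close>; a product is at most the sum of the two squares, and both squares
are integrable. Near the origin the integrand is at most 1.\<close>

lemma integrable_power_char_fun:
  fixes \<rho> \<alpha> :: real
  assumes f: "prob_density f" and \<rho>: "\<rho> > 0" and \<alpha>: "\<alpha> > 0"
    and int: "integrable lborel (\<lambda>t. t ^ (2 * r) * exp (\<rho> * \<bar>t\<bar> powr \<alpha>) * (cmod (char_fun f t))\<^sup>2)"
    and "j \<le> r"
  shows "integrable lborel (\<lambda>t. of_real (t ^ j) * char_fun f t)"
proof (rule Bochner_Integration.integrable_bound)
  interpret real_distribution "density lborel (\<lambda>x. ennreal (f x))"
    by (rule real_distribution_prob_density[OF f])
  let ?W = "\<lambda>t. t ^ (2 * r) * exp (\<rho> * \<bar>t\<bar> powr \<alpha>) * (cmod (char_fun f t))\<^sup>2"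
  let ?e = "\<lambda>t. exp (- (\<rho> * \<bar>t\<bar> powr \<alpha>))"
  have [measurable]: "char_fun f \<in> borel_measurable borel"
    unfolding char_fun_def by (rule char_measurable)
  show "integrable lborel (\<lambda>t. indicator {-1..1} t + (?W t + ?e t))"
    by (intro Bochner_Integration.integrable_add int integrable_exp_neg_abs_powr \<rho> \<alpha> integrable_real_indicator)
       (auto simp: emeasure_lborel_Icc_eq)
  show "(\<lambda>t. of_real (t ^ j) * char_fun f t) \<in> borel_measurable lborel"
    by measurable
  show "AE t in lborel. norm (of_real (t ^ j) * char_fun f t)
      \<le> norm (indicator {-1..1} t + (?W t + ?e t))"
  proof (rule AE_I2)
    fix t :: real
    have W0: "0 \<le> ?W t" by (simp add: power_mult)
    have "norm (of_real (t ^ j) * char_fun f t) = \<bar>t\<bar> ^ j * cmod (char_fun f t)"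
      by (simp add: norm_mult power_abs norm_power)
    also have "\<dots> \<le> indicator {-1..1} t + (?W t + ?e t)"
    proof (cases "\<bar>t\<bar> \<le> 1")
      case True
      have "\<bar>t\<bar> ^ j * cmod (char_fun f t) \<le> 1 * 1"
        unfolding char_fun_def using True
        by (intro mult_mono power_le_one cmod_char_le_1) auto
      moreover have "indicator {-1..1} t = (1::real)"
        using True by (simp add: indicator_def abs_le_iff)
      moreover have "0 \<le> ?e t" by simp
      ultimately show ?thesis using W0 by linarith
    next
      case False
      let ?a = "\<bar>t\<bar> ^ r * cmod (char_fun f t)" and ?b = "exp (\<rho> * \<bar>t\<bar> powr \<alpha> / 2)"
      have "\<bar>t\<bar> ^ j * cmod (char_fun f t) \<le> ?a"
        using False \<open>j \<le> r\<close> by (intro mult_right_mono power_increasing) auto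
      also have "\<dots> = (?a * ?b) * inverse ?b" by simp
      also have "\<dots> \<le> (?a * ?b)\<^sup>2 + (inverse ?b)\<^sup>2"
      proof -
        have "x * y \<le> x\<^sup>2 + y\<^sup>2" for x y :: real
          using sum_squares_bound[of x y] zero_le_power2[of x] zero_le_power2[of y] by linarith
        then show ?thesis .
      qed
      also have "(?a * ?b)\<^sup>2 = (\<bar>t\<bar> ^ r)\<^sup>2 * ?b\<^sup>2 * (cmod (char_fun f t))\<^sup>2"
        by (simp only: power_mult_distrib mult_ac)
      also have "(\<bar>t\<bar> ^ r)\<^sup>2 = t ^ (2 * r)"
        by (simp add: power_mult[symmetric] mult.commute[of r] power_even_abs)
      also have "?b\<^sup>2 = exp (\<rho> * \<bar>t\<bar> powr \<alpha>)"
        by (simp flip: exp_double)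
      also have "(inverse ?b)\<^sup>2 = ?e t"
        by (simp add: exp_minus power_inverse flip: exp_double)
      finally show ?thesis
        by (simp add: indicator_def)
    qed
    finally show "norm (of_real (t ^ j) * char_fun f t) \<le> norm (indicator {-1..1} t + (?W t + ?e t))"
      by simp
  qed
qed

section \<open>The tail factor\<close>

text \<open>\<open>W\<close> is positive just to the right of the origin, so cutting off a neighbourhood of the origin
removes a positive amount.\<close>

lemma integral_tail_less:
  fixes W :: "real \<Rightarrow> real"
  assumes W: "integrable lborel W" and W0: "\<And>t. 0 \<le> W t"
    and pos: "\<delta> > 0" "\<And>t. 0 < t \<Longrightarrow> t < \<delta> \<Longrightarrow> 0 < W t" and "T > 0"
  shows "(LINT t|lborel. indicator (- {-T..T}) t * W t) < (LINT t|lborel. W t)"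
proof -
  have W_ind: "integrable lborel (\<lambda>t. indicator A t * W t)" if "A \<in> sets borel" for A
    using integrable_mult_indicator[OF _ W, of A] that by simp
  define d where "d = min \<delta> T"
  have "d > 0" using pos(1) \<open>T > 0\<close> by (simp add: d_def)
  have "(LINT t|lborel. W t)
      = (LINT t|lborel. indicator {-T..T} t * W t + indicator (- {-T..T}) t * W t)"
    by (rule Bochner_Integration.integral_cong) (auto simp: indicator_def)
  also have "\<dots> = (LINT t|lborel. indicator {-T..T} t * W t)
      + (LINT t|lborel. indicator (- {-T..T}) t * W t)"
    by (intro Bochner_Integration.integral_add W_ind) auto
  finally have split: "(LINT t|lborel. W t) = (LINT t|lborel. indicator {-T..T} t * W t)
      + (LINT t|lborel. indicator (- {-T..T}) t * W t)" .
  have "(LINT t|lborel. indicator {-T..T} t * W t) \<noteq> 0"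
  proof
    assume "(LINT t|lborel. indicator {-T..T} t * W t) = 0"
    then have "AE t in lborel. indicator {-T..T} t * W t = 0"
      by (subst (asm) integral_nonneg_eq_0_iff_AE) (auto intro!: W_ind AE_I2 mult_nonneg_nonneg W0)
    then have "AE t in lborel. t \<notin> {d / 3..d / 2}"
    proof eventually_elim
      case (elim t)
      show ?case
      proof
        assume "t \<in> {d / 3..d / 2}"
        then have "0 < t" "t < \<delta>" "t \<in> {-T..T}"
          using \<open>d > 0\<close> by (auto simp: d_def)
        then show False
          using elim pos(2)[of t] by simp
      qed
    qed
    then have "{d / 3..d / 2} \<in> null_sets lborel"
      by (subst (asm) AE_iff_null_sets[symmetric]) auto
    then show False
      using \<open>d > 0\<close> by (simp add: null_sets_def emeasure_lborel_Icc_eq)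
  qed
  moreover have "0 \<le> (LINT t|lborel. indicator {-T..T} t * W t)"
    by (intro integral_nonneg_AE AE_I2) (simp add: W0)
  ultimately show ?thesis
    using split by linarith
qed

lemma tendsto_integral_tail:
  fixes W :: "real \<Rightarrow> real"
  assumes W: "integrable lborel W"
  shows "((\<lambda>T. LINT t|lborel. indicator (- {-T..T}) t * W t) \<longlongrightarrow> 0) at_top"
proof -
  have [measurable]: "W \<in> borel_measurable borel"
    using borel_measurable_integrable[OF W] by simp
  have "((\<lambda>T. LINT t|lborel. indicator (- {-T..T}) t * W t) \<longlongrightarrow> (LINT t|(lborel :: real measure). 0)) at_top"
  proof (rule integral_dominated_convergence_at_top[where w="\<lambda>t. norm (W t)"])
    show "AE t in lborel. ((\<lambda>T. indicator (- {-T..T}) t * W t) \<longlongrightarrow> 0) at_top"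
    proof (intro AE_I2 tendsto_eventually)
      fix t
      show "\<forall>\<^sub>F T in at_top. indicator (- {-T..T}) t * W t = 0"
        using eventually_ge_at_top[of "\<bar>t\<bar>"] by eventually_elim (auto simp: indicator_def)
    qed
    show "\<forall>\<^sub>F T in at_top. AE t in lborel. norm (indicator (- {-T..T}) t * W t) \<le> norm (W t)"
      by (intro always_eventually allI AE_I2) (simp add: indicator_def)
  qed (use W in simp_all)
  then show ?thesis by simp
qed

lemma exists_tail_factor:
  fixes W :: "real \<Rightarrow> real"
  assumes W: "integrable lborel W" and W0: "\<And>t. 0 \<le> W t"
    and pos: "\<delta> > 0" "\<And>t. 0 < t \<Longrightarrow> t < \<delta> \<Longrightarrow> 0 < W t"
  obtains \<epsilon> :: "real \<Rightarrow> real"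
  where "\<And>h. h > 0 \<Longrightarrow> 0 < \<epsilon> h \<and> \<epsilon> h < 1" "(\<epsilon> \<longlongrightarrow> 0) (at_right 0)"
    "\<And>h. h > 0 \<Longrightarrow> (LINT t|lborel. indicator (- {-(1 / h)..1 / h}) t * W t) \<le> \<epsilon> h * (LINT t|lborel. W t)"
proof -
  let ?T = "\<lambda>h. LINT t|lborel. indicator (- {-(1 / h)..1 / h}) t * W t" and ?C = "LINT t|lborel. W t"
  have T_less: "?T h < ?C" if "h > 0" for h
    using that by (intro integral_tail_less[OF W W0 pos]) auto
  have T0: "0 \<le> ?T h" for h
    by (intro integral_nonneg_AE AE_I2) (simp add: W0)
  have C: "?C > 0"
    using T0[of 1] T_less[of 1] by simp
  \<comment> \<open>The tail ratio may vanish; \<open>h / (1 + h)\<close> keeps the factor positive.\<close>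
  define \<epsilon> where "\<epsilon> h = max (?T h / ?C) (h / (1 + h))" for h
  have "(?T \<longlongrightarrow> 0) (at_right 0)"
    unfolding filterlim_at_right_to_top using tendsto_integral_tail[OF W]
    by (simp add: inverse_eq_divide)
  then have "((\<lambda>h. ?T h / ?C) \<longlongrightarrow> 0 / ?C) (at_right 0)"
    using C by (intro tendsto_intros) auto
  moreover have "((\<lambda>h. h / (1 + h)) \<longlongrightarrow> 0 / (1 + 0)) (at_right (0::real))"
    by (intro tendsto_intros) auto
  ultimately have "(\<epsilon> \<longlongrightarrow> max (0 / ?C) (0 / (1 + 0))) (at_right 0)"
    unfolding \<epsilon>_def by (rule tendsto_max)
  then have lim: "(\<epsilon> \<longlongrightarrow> 0) (at_right 0)" by simp
  show thesis
  proof (rule that[OF _ lim])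
    fix h :: real assume h: "h > 0"
    show "0 < \<epsilon> h \<and> \<epsilon> h < 1"
      using h C T_less[OF h] by (simp add: \<epsilon>_def less_max_iff_disj)
    have "?T h = ?T h / ?C * ?C" using C by simp
    also have "\<dots> \<le> \<epsilon> h * ?C"
      using C by (intro mult_right_mono) (auto simp: \<epsilon>_def)
    finally show "?T h \<le> \<epsilon> h * ?C" .
  qed
qed

section \<open>The mean integrated squared error\<close>

text \<open>For a fixed sample, the error is almost everywhere the real part of one Fourier integral. Its
integrand is \<open>(- (\<i> * t)) ^ r / (2 * pi)\<close> times the difference of the truncated empirical and the
true characteristic function, and the Plancherel inequality applies.\<close>

lemma ISE_sinc_deriv_estimator_le:
  assumes f: "prob_density f" and diff: "times_differentiable r f"
    and int: "\<And>j. j \<le> r \<Longrightarrow> integrable lborel (\<lambda>t. of_real (t ^ j) * char_fun f t)"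
    and h: "h > 0"
  shows "(\<integral>\<^sup>+ x. ennreal ((sinc_deriv_estimator r n h xs x - (deriv ^^ r) f x)\<^sup>2) \<partial>lborel)
    \<le> (\<integral>\<^sup>+ t. ennreal (t ^ (2 * r) / (2 * pi)) *
         ennreal ((cmod (indicator {- (1 / h)..1 / h} t * empirical_char n xs t - char_fun f t))\<^sup>2) \<partial>lborel)"
proof -
  let ?E = "\<lambda>t. (- (\<i> * t)) ^ r * (indicator {- (1 / h)..1 / h} t * empirical_char n xs t / (2 * pi))"
  let ?\<Phi> = "\<lambda>t. (- (\<i> * t)) ^ r * (char_fun f t / (2 * pi))"
  let ?d = "\<lambda>t. indicator {- (1 / h)..1 / h} t * empirical_char n xs t - char_fun f t"
  have E_int: "integrable lborel ?E"
    by (rule funpow_deriv_sinc_estimator(2)[OF h])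
  have "integrable lborel (\<lambda>t. (- \<i>) ^ r / (2 * pi) * (of_real (t ^ r) * char_fun f t))"
    by (intro integrable_mult_right int) simp
  then have \<Phi>_int: "integrable lborel ?\<Phi>"
    by (rule back_subst[of "integrable lborel"])
       (auto simp: power_mult_distrib fun_eq_iff power_minus[of "\<i> * _"] power_minus[of \<i>])
  have d_eq: "?E t - ?\<Phi> t = (- (\<i> * t)) ^ r / (2 * pi) * ?d t" for t
    by (simp add: diff_divide_distrib right_diff_distrib)
  have diff_meas: "(\<lambda>t. ?E t - ?\<Phi> t) \<in> borel_measurable lborel"
    by (rule borel_measurable_integrable[OF Bochner_Integration.integrable_diff[OF E_int \<Phi>_int]])
  have dens: "AE x in lborel. (deriv ^^ r) f x = Re (fourier_integral ?\<Phi> x)"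
    by (rule funpow_deriv_density[OF f diff]) (rule int)
  have "(\<integral>\<^sup>+ x. ennreal ((sinc_deriv_estimator r n h xs x - (deriv ^^ r) f x)\<^sup>2) \<partial>lborel)
      = (\<integral>\<^sup>+ x. ennreal ((Re (fourier_integral (\<lambda>t. ?E t - ?\<Phi> t) x))\<^sup>2) \<partial>lborel)"
  proof (rule nn_integral_cong_AE)
    show "AE x in lborel. ennreal ((sinc_deriv_estimator r n h xs x - (deriv ^^ r) f x)\<^sup>2)
        = ennreal ((Re (fourier_integral (\<lambda>t. ?E t - ?\<Phi> t) x))\<^sup>2)"
      using dens
      by eventually_elim
         (simp only: funpow_deriv_sinc_estimator(1)[OF h] fourier_integral_diff[OF E_int \<Phi>_int] minus_complex.sel)
  qed
  also have "\<dots> \<le> (\<integral>\<^sup>+ x. ennreal ((cmod (fourier_integral (\<lambda>t. ?E t - ?\<Phi> t) x))\<^sup>2) \<partial>lborel)"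
    by (intro nn_integral_mono ennreal_leI) (simp add: cmod_power2)
  also have "\<dots> \<le> ennreal (2 * pi) * (\<integral>\<^sup>+ t. ennreal ((cmod (?E t - ?\<Phi> t))\<^sup>2) \<partial>lborel)"
    by (intro plancherel_le Bochner_Integration.integrable_diff E_int \<Phi>_int)
  also have "\<dots> = (\<integral>\<^sup>+ t. ennreal (2 * pi) * ennreal ((cmod (?E t - ?\<Phi> t))\<^sup>2) \<partial>lborel)"
    by (rule nn_integral_cmult[symmetric], rule measurable_compose[OF diff_meas, of "\<lambda>z. ennreal ((cmod z)\<^sup>2)"])
       measurable
  also have "\<dots> = (\<integral>\<^sup>+ t. ennreal (t ^ (2 * r) / (2 * pi)) * ennreal ((cmod (?d t))\<^sup>2) \<partial>lborel)"
  proof (rule nn_integral_cong)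
    fix t :: real
    have "2 * pi * (cmod (?E t - ?\<Phi> t))\<^sup>2 = 2 * pi * ((\<bar>t\<bar> ^ r)\<^sup>2 / (2 * pi)\<^sup>2 * (cmod (?d t))\<^sup>2)"
      unfolding d_eq by (simp only: norm_mult norm_divide norm_power norm_minus_cancel norm_ii norm_of_real
          power_mult_distrib power_divide mult_1) simp
    also have "(\<bar>t\<bar> ^ r)\<^sup>2 = t ^ (2 * r)"
      by (simp add: power_mult[symmetric] mult.commute[of r] power_even_abs)
    finally have eq: "2 * pi * (cmod (?E t - ?\<Phi> t))\<^sup>2 = t ^ (2 * r) / (2 * pi) * (cmod (?d t))\<^sup>2"
      by (simp add: power2_eq_square)
    have merge: "ennreal a * ennreal (x\<^sup>2) = ennreal (a * x\<^sup>2)" if "0 \<le> a" for a x :: real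
      using that by (simp add: ennreal_mult)
    have "0 \<le> 2 * pi" "0 \<le> t ^ (2 * r) / (2 * pi)"
      by (simp_all add: power_mult)
    then show "ennreal (2 * pi) * ennreal ((cmod (?E t - ?\<Phi> t))\<^sup>2)
        = ennreal (t ^ (2 * r) / (2 * pi)) * ennreal ((cmod (?d t))\<^sup>2)"
      by (simp only: merge eq)
  qed
  finally show ?thesis .
qed

text \<open>Bias and variance separate on the frequency side. After exchanging expectation and frequency
integral, the frequencies \<open>\<bar>t\<bar> \<le> 1 / h\<close> contribute variance only, at most \<open>1 / n\<close> each, and the
others contribute the deterministic bias. Bounding \<open>t ^ (2 * r)\<close> by its maximum on the window
gives the first summand.\<close>

lemma MISE_sinc_deriv_estimator_le:
  fixes X :: "nat \<Rightarrow> 'a \<Rightarrow> real"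
  assumes f: "prob_density f" and diff: "times_differentiable r f"
    and int: "\<And>j. j \<le> r \<Longrightarrow> integrable lborel (\<lambda>t. of_real (t ^ j) * char_fun f t)"
    and h: "h > 0" and n: "n \<ge> 1" and iid: "iid_sample M n X f"
  shows "MISE M X f r n h
    \<le> ennreal (1 / (pi * real n * h ^ (2 * r + 1)))
      + (\<integral>\<^sup>+ t. ennreal (indicator (- {- (1 / h)..1 / h}) t * t ^ (2 * r) * (cmod (char_fun f t))\<^sup>2 / (2 * pi)) \<partial>lborel)"
proof -
  let ?A = "{- (1 / h)..1 / h}"
  let ?d = "\<lambda>\<omega> t. indicator ?A t * empirical_char n (\<lambda>j. X j \<omega>) t - char_fun f t"
  let ?tail = "\<lambda>t. indicator (- ?A) t * t ^ (2 * r) * (cmod (char_fun f t))\<^sup>2 / (2 * pi)"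
  let ?c = "(1 / h) ^ (2 * r) / (2 * pi) * (1 / n)"
  interpret prob_space M using iid by (simp add: iid_sample_def)
  interpret pair_sigma_finite M "lborel :: real measure" ..
  interpret D: real_distribution "density lborel (\<lambda>x. ennreal (f x))"
    by (rule real_distribution_prob_density[OF f])
  have [measurable]: "char_fun f \<in> borel_measurable borel"
    unfolding char_fun_def by (rule D.char_measurable)
  have X_meas [measurable]: "X j \<in> borel_measurable M" if "j \<in> {1..n}" for j
    using iid that by (auto simp: iid_sample_def distributed_def)
  have emp_meas [measurable]:
    "(\<lambda>p. empirical_char n (\<lambda>j. X j (fst p)) (snd p)) \<in> borel_measurable (M \<Otimes>\<^sub>M borel)"
    unfolding empirical_char_def by measurable
  have "MISE M X f r n h \<le> (\<integral>\<^sup>+ \<omega>. \<integral>\<^sup>+ t. ennreal (t ^ (2 * r) / (2 * pi)) * ennreal ((cmod (?d \<omega> t))\<^sup>2) \<partial>lborel \<partial>M)"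
    unfolding MISE_def by (intro nn_integral_mono ISE_sinc_deriv_estimator_le f diff int h)
  also have "\<dots> = (\<integral>\<^sup>+ t. \<integral>\<^sup>+ \<omega>. ennreal (t ^ (2 * r) / (2 * pi)) * ennreal ((cmod (?d \<omega> t))\<^sup>2) \<partial>M \<partial>lborel)"
    by (rule Fubini'[symmetric]) (simp add: split_beta', measurable)
  also have "\<dots> \<le> (\<integral>\<^sup>+ t. ennreal (indicator ?A t * ?c) + ennreal (?tail t) \<partial>lborel)"
  proof (rule nn_integral_mono)
    fix t :: real
    have emp_t [measurable]: "(\<lambda>\<omega>. empirical_char n (\<lambda>j. X j \<omega>) t) \<in> borel_measurable M"
      using measurable_compose[OF measurable_Pair2'[of t borel M] emp_meas] by simp
    have "(\<integral>\<^sup>+ \<omega>. ennreal (t ^ (2 * r) / (2 * pi)) * ennreal ((cmod (?d \<omega> t))\<^sup>2) \<partial>M)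
        = ennreal (t ^ (2 * r) / (2 * pi)) * (\<integral>\<^sup>+ \<omega>. ennreal ((cmod (?d \<omega> t))\<^sup>2) \<partial>M)"
      by (rule nn_integral_cmult) measurable
    also have "\<dots> \<le> ennreal (indicator ?A t * ?c) + ennreal (?tail t)"
    proof (cases "t \<in> ?A")
      case True
      have "ennreal (t ^ (2 * r) / (2 * pi)) * (\<integral>\<^sup>+ \<omega>. ennreal ((cmod (?d \<omega> t))\<^sup>2) \<partial>M)
          \<le> ennreal ((1 / h) ^ (2 * r) / (2 * pi)) * ennreal (1 / n)"
      proof (rule mult_mono)
        have "\<bar>t\<bar> ^ (2 * r) \<le> (1 / h) ^ (2 * r)"
          using True by (intro power_mono) auto
        then show "ennreal (t ^ (2 * r) / (2 * pi)) \<le> ennreal ((1 / h) ^ (2 * r) / (2 * pi))"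
          by (intro ennreal_leI divide_right_mono) (auto simp: power_even_abs)
        show "(\<integral>\<^sup>+ \<omega>. ennreal ((cmod (?d \<omega> t))\<^sup>2) \<partial>M) \<le> ennreal (1 / n)"
          using expectation_empirical_char_error_le[OF iid n, of t] True f
          by (simp add: prob_density_def)
      qed auto
      also have "\<dots> = ennreal (indicator ?A t * ?c)"
        using True h by (subst ennreal_mult[symmetric]) auto
      finally show ?thesis
        by (rule order_trans) simp
    next
      case False
      then show ?thesis
        by (simp add: emeasure_space_1 ennreal_mult[symmetric] power_mult)
    qed
    finally show "(\<integral>\<^sup>+ \<omega>. ennreal (t ^ (2 * r) / (2 * pi)) * ennreal ((cmod (?d \<omega> t))\<^sup>2) \<partial>M)
        \<le> ennreal (indicator ?A t * ?c) + ennreal (?tail t)" .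
  qed
  also have "\<dots> = (\<integral>\<^sup>+ t. ennreal (indicator ?A t * ?c) \<partial>lborel) + (\<integral>\<^sup>+ t. ennreal (?tail t) \<partial>lborel)"
    by (rule nn_integral_add) measurable
  also have "(\<integral>\<^sup>+ t. ennreal (indicator ?A t * ?c) \<partial>lborel) = (\<integral>\<^sup>+ t. ennreal ?c * indicator ?A t \<partial>lborel)"
    by (rule nn_integral_cong) (simp add: indicator_def)
  also have "\<dots> = ennreal ?c * ennreal (2 / h)"
    using h by (simp add: nn_integral_cmult_indicator emeasure_lborel_Icc_eq)
  also have "\<dots> = ennreal (?c * (2 / h))"
    using h by (subst ennreal_mult) auto
  also have "?c * (2 / h) = 1 / (pi * real n * h ^ (2 * r + 1))"
    using h n by (simp add: field_simps power_divide)
  finally show ?thesis .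
qed

theorem theorem9p2:
  fixes r :: nat and f :: "real \<Rightarrow> real" and \<rho> \<alpha> C :: real
  assumes "prob_density f"
    and "times_differentiable r f"
    and "\<rho> > 0" and "0 < \<alpha>" and "\<alpha> \<le> 2"
    and "integrable lborel (\<lambda>t. t ^ (2 * r) * exp (\<rho> * \<bar>t\<bar> powr \<alpha>) * (cmod (char_fun f t))\<^sup>2)"
    and "1 / (2 * pi) *
      (LINT t|lborel. t ^ (2 * r) * exp (\<rho> * \<bar>t\<bar> powr \<alpha>) * (cmod (char_fun f t))\<^sup>2) = C"
  shows "\<exists>\<epsilon> :: real \<Rightarrow> real.
    (\<forall>h>0. 0 < \<epsilon> h \<and> \<epsilon> h < 1) \<and>
    (\<epsilon> \<longlongrightarrow> 0) (at_right 0) \<and>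
    (\<forall>n\<ge>1. \<forall>h>0. \<forall>(M :: 'a measure) X. iid_sample M n X f \<longrightarrow>
      MISE M X f r n h
        \<le> ennreal (\<epsilon> h * C * exp (- \<rho> / h powr \<alpha>) + 1 / (pi * real n * h ^ (2 * r + 1))))"
proof -
  note f = assms(1) and \<rho> = assms(3) and \<alpha> = assms(4) and W_int = assms(6)
  let ?W = "\<lambda>t. t ^ (2 * r) * exp (\<rho> * \<bar>t\<bar> powr \<alpha>) * (cmod (char_fun f t))\<^sup>2"
  interpret D: real_distribution "density lborel (\<lambda>x. ennreal (f x))"
    by (rule real_distribution_prob_density[OF f])
  have W0: "0 \<le> ?W t" for t by (simp add: power_mult)
  have "char_fun f 0 \<noteq> 0" and "isCont (char_fun f) 0"
    unfolding char_fun_def using D.char_zero D.isCont_char by auto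
  then obtain \<delta> where "\<delta> > 0" and \<delta>: "\<And>t. dist 0 t < \<delta> \<Longrightarrow> char_fun f t \<noteq> 0"
    using continuous_at_avoid[of 0 "char_fun f" 0] by blast
  have W_pos: "0 < ?W t" if "0 < t" "t < \<delta>" for t
    using that \<delta>[of t] by simp
  obtain \<epsilon> where \<epsilon>: "\<And>h. h > 0 \<Longrightarrow> 0 < \<epsilon> h \<and> \<epsilon> h < 1" "(\<epsilon> \<longlongrightarrow> 0) (at_right 0)"
    and tail: "\<And>h. h > 0 \<Longrightarrow> (LINT t|lborel. indicator (- {-(1 / h)..1 / h}) t * ?W t) \<le> \<epsilon> h * (LINT t|lborel. ?W t)"
    using exists_tail_factor[OF W_int W0 \<open>\<delta> > 0\<close> W_pos] by blast
  have C0: "0 \<le> C"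
    unfolding assms(7)[symmetric] by (intro mult_nonneg_nonneg integral_nonneg_AE AE_I2 W0) auto
  have bound: "MISE M X f r n h
        \<le> ennreal (\<epsilon> h * C * exp (- \<rho> / h powr \<alpha>) + 1 / (pi * real n * h ^ (2 * r + 1)))"
    if n: "n \<ge> 1" and h: "h > 0" and iid: "iid_sample M n X f" for n h and M :: "'a measure" and X
  proof -
    let ?B = "- {-(1 / h)..1 / h}" and ?e = "exp (- \<rho> / h powr \<alpha>)"
    have B_int: "integrable lborel (\<lambda>t. indicator ?B t * ?W t)"
      using integrable_mult_indicator[OF _ W_int, of ?B] by simp
    \<comment> \<open>Beyond \<open>1 / h\<close> the exponential weight is at least \<open>exp (\<rho> / h powr \<alpha>)\<close>.\<close>
    have "indicator ?B t * t ^ (2 * r) * (cmod (char_fun f t))\<^sup>2 / (2 * pi)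
        \<le> ?e / (2 * pi) * (indicator ?B t * ?W t)" for t
    proof (cases "t \<in> ?B")
      case True
      then have "1 / h \<le> \<bar>t\<bar>" by auto
      then have "(1 / h) powr \<alpha> \<le> \<bar>t\<bar> powr \<alpha>"
        using h \<alpha> by (intro powr_mono2) auto
      then have "\<rho> / h powr \<alpha> \<le> \<rho> * \<bar>t\<bar> powr \<alpha>"
        using \<rho> h by (simp add: powr_divide field_simps)
      then have "1 \<le> ?e * exp (\<rho> * \<bar>t\<bar> powr \<alpha>)"
        by (simp add: exp_add[symmetric])
      then have "t ^ (2 * r) * (cmod (char_fun f t))\<^sup>2 / (2 * pi) * 1
          \<le> t ^ (2 * r) * (cmod (char_fun f t))\<^sup>2 / (2 * pi) * (?e * exp (\<rho> * \<bar>t\<bar> powr \<alpha>))"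
        by (rule mult_left_mono) (simp add: power_mult)
      then show ?thesis using True by (simp add: mult_ac)
    qed simp
    then have "(\<integral>\<^sup>+ t. ennreal (indicator ?B t * t ^ (2 * r) * (cmod (char_fun f t))\<^sup>2 / (2 * pi)) \<partial>lborel)
        \<le> (\<integral>\<^sup>+ t. ennreal (?e / (2 * pi) * (indicator ?B t * ?W t)) \<partial>lborel)"
      by (intro nn_integral_mono ennreal_leI)
    also have "\<dots> = ennreal (LINT t|lborel. ?e / (2 * pi) * (indicator ?B t * ?W t))"
      using W0 by (intro nn_integral_eq_integral integrable_mult_right B_int AE_I2) auto
    also have "(LINT t|lborel. ?e / (2 * pi) * (indicator ?B t * ?W t))
        = ?e / (2 * pi) * (LINT t|lborel. indicator ?B t * ?W t)"
      by (rule integral_mult_right_zero)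
    also have "\<dots> \<le> ?e / (2 * pi) * (\<epsilon> h * (LINT t|lborel. ?W t))"
      by (intro mult_left_mono tail h) simp
    also have "\<dots> = \<epsilon> h * C * ?e"
      unfolding assms(7)[symmetric] by simp
    finally have "(\<integral>\<^sup>+ t. ennreal (indicator ?B t * t ^ (2 * r) * (cmod (char_fun f t))\<^sup>2 / (2 * pi)) \<partial>lborel)
        \<le> ennreal (\<epsilon> h * C * ?e)"
      by (simp add: ennreal_leI)
    then have "MISE M X f r n h
        \<le> ennreal (1 / (pi * real n * h ^ (2 * r + 1))) + ennreal (\<epsilon> h * C * ?e)"
      by (intro order_trans[OF MISE_sinc_deriv_estimator_le[OF f assms(2) _ h n iid]] add_left_mono
          integrable_power_char_fun[OF f \<rho> \<alpha> W_int])
    also have "\<dots> = ennreal (\<epsilon> h * C * ?e + 1 / (pi * real n * h ^ (2 * r + 1)))"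
      using \<epsilon>(1)[OF h] C0 h by (subst ennreal_plus[symmetric]) (auto simp: add.commute)
    finally show ?thesis .
  qed
  show ?thesis
    using \<epsilon> bound by (intro exI[of _ \<epsilon>]) blast
qed

end
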